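(* Let $\mathsf k$ be a field and let $G$ be a graph. If $G$ admits an admissible labeling, then there is a complete local equidimensional ring $R$ such that $\Gamma_R$ is graph-isomorphic to $G$. Moreover, the ring $R$ can be taken of the form $\mathsf k[\![X_1,\ldots,X_n]\!]/I$ where $I$ is generated by square-free monomials in the variables $X_1,\ldots,X_n$.
   Context: All rings are commutative and noetherian; graphs are finite, simple and undirected. A local ring $R$ is equidimensional if $\dim(R/\mathfrak p)=\dim(R)$ for every minimal prime $\mathfrak p$ of $R$. For an equidimensional local ring $R$, $\Gamma_R$ is the graph whose vertices are the minimal primes of $R$, with distinct minimal primes $\mathfrak p,\mathfrak q$ adjacent if and only if $\operatorname{ht}_R(\mathfrak p+\mathfrak q)=1$. Admissible labeling: let $G$ be a graph with vertex set $V=\{v_1,\ldots,v_d\}$, $d=|V|$. For positive integers $n,s$ write $[n]=\{1,\ldots,n\}$ and let $\binom{[n]}{s}$ be the set of subsets of $[n]$ of cardinality $s$. An admissible labeling of $G$ is an injective function $\phi\colon V\to\binom{[n]}{s}$, for some choice of $n$ and $s$, such that (1) $\phi(v_1)\cup\cdots\cup\phi(v_d)=[n]$, and (2) for all vertices $v,w$, $v$ is adjacent to $w$ in $G$ if and only if $|\phi(v)\cap\phi(w)|=s-1$ (equivalently, $|\phi(v)\cup\phi(w)|=s+1$). *)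

theory Defs
  imports
    "HOL-Algebra.Ring_Divisibility"
    "HOL-Algebra.QuotRing"
    "HOL-Algebra.Ideal_Product"
    "HOL-Library.Multiset"
    "HOL-Library.Extended_Nat"
    "Graph_Theory.Pair_Digraph"
    "Graph_Theory.Digraph_Isomorphism"
begin

section \<open>Complete local rings\<close>

locale noetherian_local_ring = cring R + noetherian_ring R for R (structure) +
  assumes unique_maximalideal: "\<exists>!m. maximalideal m R"

text \<open>
  Powers of ideals are taken in \<^const>\<open>ideals_set\<close>, whose multiplication is the product of ideals.
  Completeness means that the topology defined by the powers of the maximal ideal is
  separated and that every Cauchy sequence converges.
\<close>

locale complete_local_ring = noetherian_local_ring +
  assumes adic_separated:
      "maximalideal m R \<Longrightarrow> (\<Inter>k::nat. m [^]\<^bsub>ideals_set R\<^esub> k) = {\<zero>}"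
    and adic_complete:
      "\<lbrakk> maximalideal m R;
         \<And>i::nat. x i \<in> carrier R;
         \<And>k::nat. \<exists>N. \<forall>i\<ge>N. \<forall>j\<ge>N. x i \<ominus> x j \<in> m [^]\<^bsub>ideals_set R\<^esub> k \<rbrakk>
       \<Longrightarrow> \<exists>y\<in>carrier R. \<forall>k::nat. \<exists>N. \<forall>i\<ge>N. x i \<ominus> y \<in> m [^]\<^bsub>ideals_set R\<^esub> k"


section \<open>Dimension and height\<close>

definition prime_chain :: "('a, 'b) ring_scheme \<Rightarrow> nat \<Rightarrow> (nat \<Rightarrow> 'a set) \<Rightarrow> bool"
  where "prime_chain R k P \<longleftrightarrow>
    (\<forall>i\<le>k. primeideal (P i) R) \<and> (\<forall>i<k. P i \<subset> P (Suc i))"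

text \<open>As the values are in \<^typ>\<open>enat\<close>, the zero ring gets dimension \<open>0\<close>.\<close>

definition krull_dim :: "('a, 'b) ring_scheme \<Rightarrow> enat"
  where "krull_dim R = (SUP k\<in>{k. \<exists>P. prime_chain R k P}. enat k)"

definition prime_height :: "('a, 'b) ring_scheme \<Rightarrow> 'a set \<Rightarrow> enat"
  where "prime_height R p = (SUP k\<in>{k. \<exists>P. prime_chain R k P \<and> P k = p}. enat k)"

text \<open>The improper ideal has height \<open>\<infinity>\<close>, the infimum of the empty set.\<close>

definition ideal_height :: "('a, 'b) ring_scheme \<Rightarrow> 'a set \<Rightarrow> enat"
  where "ideal_height R I = (INF p\<in>{p. primeideal p R \<and> I \<subseteq> p}. prime_height R p)"

definition minimal_primes :: "('a, 'b) ring_scheme \<Rightarrow> 'a set set"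
  where "minimal_primes R = {p. primeideal p R \<and> (\<forall>q. primeideal q R \<and> q \<subseteq> p \<longrightarrow> q = p)}"

definition equidimensional :: "('a, 'b) ring_scheme \<Rightarrow> bool"
  where "equidimensional R \<longleftrightarrow> (\<forall>p\<in>minimal_primes R. krull_dim (R Quot p) = krull_dim R)"


section \<open>The graph of minimal primes\<close>

text \<open>
  Following \<^locale>\<open>pair_graph\<close>, an undirected simple graph is represented by its vertex set and
  its irreflexive symmetric adjacency relation.
\<close>

definition minimal_prime_graph :: "('a, 'b) ring_scheme \<Rightarrow> 'a set pair_pre_digraph"
  where "minimal_prime_graph R =
    \<lparr> pverts = minimal_primes R,
      parcs = {(p, q). p \<in> minimal_primes R \<and> q \<in> minimal_primes R \<and> p \<noteq> q \<and>
                       ideal_height R (p <+>\<^bsub>R\<^esub> q) = 1} \<rparr>"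

definition admissible_labeling ::
    "'v pair_pre_digraph \<Rightarrow> nat \<Rightarrow> nat \<Rightarrow> ('v \<Rightarrow> nat set) \<Rightarrow> bool"
  where "admissible_labeling G n s \<phi> \<longleftrightarrow>
    n > 0 \<and> s > 0 \<and>
    \<phi> ` pverts G \<subseteq> {A. A \<subseteq> {1..n} \<and> card A = s} \<and>
    inj_on \<phi> (pverts G) \<and>
    (\<Union>v\<in>pverts G. \<phi> v) = {1..n} \<and>
    (\<forall>v\<in>pverts G. \<forall>w\<in>pverts G. (v, w) \<in> parcs G \<longleftrightarrow> card (\<phi> v \<inter> \<phi> w) = s - 1)"


section \<open>Formal power series in several variables\<close>

text \<open>
  A monomial in the variables \<open>X\<^sub>i\<close>, \<open>i \<in> V\<close>, is a multiset over \<open>V\<close>, as in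
  HOL-Algebra's theory of indexed polynomials; a series maps each monomial to its coefficient,
  and multisets that involve an index outside \<open>V\<close> to zero.
\<close>

definition power_series_ring ::
    "('k, 'b) ring_scheme \<Rightarrow> 'i set \<Rightarrow> ('i multiset \<Rightarrow> 'k) ring"
  where "power_series_ring K V =
    \<lparr> carrier = {f. (\<forall>m. f m \<in> carrier K) \<and> (\<forall>m. \<not> set_mset m \<subseteq> V \<longrightarrow> f m = \<zero>\<^bsub>K\<^esub>)},
      mult = (\<lambda>f g m. \<Oplus>\<^bsub>K\<^esub>a\<in>{a. a \<subseteq># m}. f a \<otimes>\<^bsub>K\<^esub> g (m - a)),
      one = (\<lambda>m. if m = {#} then \<one>\<^bsub>K\<^esub> else \<zero>\<^bsub>K\<^esub>),
      zero = (\<lambda>m. \<zero>\<^bsub>K\<^esub>),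
      add = (\<lambda>f g m. f m \<oplus>\<^bsub>K\<^esub> g m) \<rparr>"

definition monomial :: "('k, 'b) ring_scheme \<Rightarrow> 'i multiset \<Rightarrow> 'i multiset \<Rightarrow> 'k"
  where "monomial K a = (\<lambda>m. if m = a then \<one>\<^bsub>K\<^esub> else \<zero>\<^bsub>K\<^esub>)"

text \<open>The square-free monomials are the products of distinct variables.\<close>

definition squarefree_monomials ::
    "('k, 'b) ring_scheme \<Rightarrow> 'i set \<Rightarrow> ('i multiset \<Rightarrow> 'k) set"
  where "squarefree_monomials K V = {monomial K (mset_set A) | A. finite A \<and> A \<subseteq> V}"

end

theory Submission
  imports Defs "HOL-Computational_Algebra.Primes" "HOL-Library.Infinite_Set"
begin

text \<open>
  Let \<open>S\<close> be the ring of power series over \<open>K\<close> in \<open>X\<^sub>1, \<dots>, X\<^sub>n\<close>. For a set \<open>A\<close> of indices let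
  \<open>P A\<close> (below: \<open>variable_ideal A\<close>) be the ideal of \<open>S\<close> generated by the \<open>X\<^sub>i\<close> with
  \<open>i \<in> A\<close>; it is prime. The ring is
  \<open>R = S / I\<close>, where \<open>I\<close> is the intersection of the \<open>P (\<phi> v)\<close> over all vertices \<open>v\<close>. A monomial lies
  in \<open>I\<close> iff its set of variables meets every \<open>\<phi> v\<close>. This depends on the set of variables alone, so
  \<open>I\<close> is generated by square-free monomials.

  Dimensions and heights come from three observations on prime ideals of \<open>S\<close>, and the value of
  \<open>dim S\<close> never enters.

  \<^item> A prime \<open>Q\<close> containing \<open>I\<close> contains some \<open>P (\<phi> v)\<close>: otherwise pick for every \<open>v\<close> a variable of
    \<open>\<phi> v\<close> outside \<open>Q\<close>; the product of these variables lies in \<open>I\<close>, but not in \<open>Q\<close>. So the minimal primes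
    of \<open>R\<close> are the images of the \<open>P (\<phi> v)\<close>, which form an antichain as all \<open>\<phi> v\<close> have \<open>s\<close> elements
    (\<open>prime_over_I\<close>, \<open>minimal_primes_R\<close>).
  \<^item> A permutation of the variables is an automorphism of \<open>S\<close>, so the dimension of \<open>S / P A\<close> depends
    only on the cardinality of \<open>A\<close>. Hence all components of \<open>R\<close> have equal dimension
    (\<open>dim_over_variable_ideal_eq\<close>, \<open>equidimensional_R\<close>).
  \<^item> No prime lies strictly between \<open>P A\<close> and \<open>P (insert i A)\<close> (\<open>no_prime_between\<close>). The sum of \<open>P A\<close>
    and \<open>P B\<close> is \<open>P (A \<union> B)\<close>. If \<open>A \<union> B\<close> has \<open>s + 1\<close> elements, a chain of primes over \<open>I\<close> that ends in
    \<open>P (A \<union> B)\<close> starts above some \<open>P D\<close> with only one index less, so it has at most one step. If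
    \<open>A \<union> B\<close> is larger, adjoining the variables to \<open>P A\<close> in two instalments gives a chain with two
    steps. So the height of the sum in \<open>R\<close> is 1 iff \<open>A\<close> and \<open>B\<close> share \<open>s - 1\<close> elements
    (\<open>ideal_height_sum\<close>).

  That \<open>S\<close> is noetherian and local follows from division by leading terms
  (\<open>ideal_eq_genideal_lead\<close>). Sending the variables to distinct primes embeds the monomials into the
  positive integers, multiplicatively; comparing the images is a well-order of monomials in which
  every monomial has finitely many predecessors, and the leading term of a series is its least one.
  Together with Dickson's lemma, division makes every ideal finitely generated; division by a single
  series with nonzero constant term shows that it is a unit.

  Completeness of \<open>R\<close> holds because \<open>I\<close> is a monomial ideal: every residue class has a unique
  representative without terms in \<open>I\<close>, and an element of \<open>R\<close> lies in the \<open>k\<close>-th power of the maximal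
  ideal iff this representative has order at least \<open>k\<close>
  (\<open>complete_local_ring_monomial_quotient\<close>).
\<close>

section \<open>Formal power series rings\<close>

lemma (in abelian_monoid) finsum_Sigma:
  assumes "finite A" and "\<And>a. a \<in> A \<Longrightarrow> finite (B a)"
    and "\<And>a b. a \<in> A \<Longrightarrow> b \<in> B a \<Longrightarrow> f a b \<in> carrier G"
  shows "(\<Oplus>a\<in>A. \<Oplus>b\<in>B a. f a b) = (\<Oplus>x\<in>Sigma A B. f (fst x) (snd x))"
  using assms
proof (induction A rule: finite_induct)
  case empty
  then show ?case by simp
next
  case (insert x A)
  have split: "Sigma (insert x A) B = Pair x ` B x \<union> Sigma A B"
    by auto
  have "(\<Oplus>y\<in>Sigma (insert x A) B. f (fst y) (snd y))
      = (\<Oplus>y\<in>Pair x ` B x. f (fst y) (snd y)) \<oplus> (\<Oplus>x\<in>Sigma A B. f (fst x) (snd x))"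
    unfolding split using insert by (intro finsum_Un_disjoint) (auto simp: Pi_def)
  also have "(\<Oplus>y\<in>Pair x ` B x. f (fst y) (snd y)) = (\<Oplus>b\<in>B x. f x b)"
    using insert by (subst finsum_reindex) (auto simp: Pi_def inj_on_def)
  also have "(\<Oplus>x\<in>Sigma A B. f (fst x) (snd x)) = (\<Oplus>a\<in>A. \<Oplus>b\<in>B a. f a b)"
    using insert by simp
  finally show ?case
    using insert by (subst finsum_insert) (auto simp: Pi_def)
qed

lemma finite_submultisets: "finite {a. a \<subseteq># m}"
proof (induction m)
  case empty
  then show ?case by simp
next
  case (add x m)
  have "a \<in> {a. a \<subseteq># m} \<union> add_mset x ` {a. a \<subseteq># m}" if "a \<subseteq># add_mset x m" for a
  proof (cases "x \<in># a")
    case True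
    then obtain b where "a = add_mset x b"
      by (metis mset_add)
    with that show ?thesis
      by auto
  next
    case False
    obtain d where d: "add_mset x m = a + d"
      using \<open>a \<subseteq># add_mset x m\<close> unfolding mset_subset_eq_exists_conv by blast
    with False have "x \<in># d"
      by (metis union_iff union_single_eq_member)
    then obtain e where "d = add_mset x e"
      by (metis mset_add)
    with d show ?thesis
      by simp
  qed
  then have "{a. a \<subseteq># add_mset x m} \<subseteq> {a. a \<subseteq># m} \<union> add_mset x ` {a. a \<subseteq># m}"
    by blast
  with add show ?case
    by (metis finite_UnI finite_imageI finite_subset)
qed

locale power_series = cring K for K :: "('k, 'b) ring_scheme" (structure) +
  fixes V :: "'i set"
begin

abbreviation S :: "('i multiset \<Rightarrow> 'k) ring"
  where "S \<equiv> power_series_ring K V"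

abbreviation monomials :: "'i multiset set"
  where "monomials \<equiv> {m. set_mset m \<subseteq> V}"

lemma series_carrier_iff:
  "f \<in> carrier S \<longleftrightarrow> (\<forall>m. f m \<in> carrier K) \<and> (\<forall>m. m \<notin> monomials \<longrightarrow> f m = \<zero>)"
  unfolding power_series_ring_def by auto

lemma coeff_closed [simp]: "f \<in> carrier S \<Longrightarrow> f m \<in> carrier K"
  by (simp add: series_carrier_iff)

lemma coeff_outside: "f \<in> carrier S \<Longrightarrow> \<not> set_mset m \<subseteq> V \<Longrightarrow> f m = \<zero>"
  by (simp add: series_carrier_iff)

lemma coeff_mult: "(f \<otimes>\<^bsub>S\<^esub> g) m = (\<Oplus>a\<in>{a. a \<subseteq># m}. f a \<otimes> g (m - a))"
  unfolding power_series_ring_def by simp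

lemma coeff_add [simp]: "(f \<oplus>\<^bsub>S\<^esub> g) m = f m \<oplus> g m"
  unfolding power_series_ring_def by simp

lemma coeff_zero [simp]: "\<zero>\<^bsub>S\<^esub> m = \<zero>"
  unfolding power_series_ring_def by simp

lemma one_series: "\<one>\<^bsub>S\<^esub> = monomial K {#}"
  unfolding power_series_ring_def monomial_def by simp

lemma coeff_monomial: "monomial K a m = (if m = a then \<one> else \<zero>)"
  by (simp add: monomial_def)

lemma monomial_closed [simp]: "set_mset a \<subseteq> V \<Longrightarrow> monomial K a \<in> carrier S"
  by (auto simp: series_carrier_iff monomial_def)

lemma series_mult_closed: "f \<in> carrier S \<Longrightarrow> g \<in> carrier S \<Longrightarrow> f \<otimes>\<^bsub>S\<^esub> g \<in> carrier S"
proof -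
  assume fg: "f \<in> carrier S" "g \<in> carrier S"
  have "(f \<otimes>\<^bsub>S\<^esub> g) m = \<zero>" if "\<not> set_mset m \<subseteq> V" for m
    unfolding coeff_mult
  proof (rule add.finprod_one_eqI)
    fix a assume "a \<in> {a. a \<subseteq># m}"
    then have "set_mset m = set_mset a \<union> set_mset (m - a)"
      by (auto simp: mset_subset_eq_exists_conv)
    with that have "\<not> set_mset a \<subseteq> V \<or> \<not> set_mset (m - a) \<subseteq> V"
      by blast
    then have "f a = \<zero> \<or> g (m - a) = \<zero>"
      using fg coeff_outside by blast
    with fg show "f a \<otimes> g (m - a) = \<zero>"
      by auto
  qed
  moreover have "(f \<otimes>\<^bsub>S\<^esub> g) m \<in> carrier K" for m
    unfolding coeff_mult using fg by (intro finsum_closed) auto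
  ultimately show ?thesis
    by (simp add: series_carrier_iff)
qed

lemma series_m_comm:
  assumes "f \<in> carrier S" "g \<in> carrier S"
  shows "f \<otimes>\<^bsub>S\<^esub> g = g \<otimes>\<^bsub>S\<^esub> f"
proof
  fix m :: "'i multiset"
  have double_diff: "m - (m - a) = a" if "a \<subseteq># m" for a
    using that by (auto simp: mset_subset_eq_exists_conv)
  have bij: "(\<lambda>a. m - a) ` {a. a \<subseteq># m} = {a. a \<subseteq># m}"
  proof -
    have "a \<in> (\<lambda>a. m - a) ` {a. a \<subseteq># m}" if "a \<subseteq># m" for a
      using double_diff[OF that] by (intro image_eqI[of _ _ "m - a"]) simp_all
    then show ?thesis
      by auto
  qed
  have inj: "inj_on (\<lambda>a. m - a) {a. a \<subseteq># m}"
    by (rule inj_on_inverseI[of _ "\<lambda>a. m - a"]) (simp add: double_diff)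
  have "(f \<otimes>\<^bsub>S\<^esub> g) m = (\<Oplus>a\<in>(\<lambda>a. m - a) ` {a. a \<subseteq># m}. f a \<otimes> g (m - a))"
    by (simp add: coeff_mult bij)
  also have "\<dots> = (\<Oplus>a\<in>{a. a \<subseteq># m}. f (m - a) \<otimes> g (m - (m - a)))"
    using assms by (intro finsum_reindex inj) auto
  also have "\<dots> = (g \<otimes>\<^bsub>S\<^esub> f) m"
    unfolding coeff_mult using assms
    by (intro finsum_cong') (simp_all add: m_comm double_diff)
  finally show "(f \<otimes>\<^bsub>S\<^esub> g) m = (g \<otimes>\<^bsub>S\<^esub> f) m" .
qed

text \<open>
  Both bracketings sum over the decompositions of \<open>m\<close> into three monomials. The left one is indexed by
  pairs \<open>b \<subseteq># a \<subseteq># m\<close>, the right one by the first two parts \<open>b\<close> and \<open>c = a - b\<close>.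
\<close>

lemma series_m_assoc:
  assumes "f \<in> carrier S" "g \<in> carrier S" "h \<in> carrier S"
  shows "f \<otimes>\<^bsub>S\<^esub> g \<otimes>\<^bsub>S\<^esub> h = f \<otimes>\<^bsub>S\<^esub> (g \<otimes>\<^bsub>S\<^esub> h)"
proof
  fix m
  let ?D = "\<lambda>m. {a. a \<subseteq># (m :: 'i multiset)}"
  let ?j = "\<lambda>(b, c). (b + c, b)"
  have img: "Sigma (?D m) ?D = ?j ` Sigma (?D m) (\<lambda>b. ?D (m - b))"
  proof -
    have "(a, b) \<in> ?j ` Sigma (?D m) (\<lambda>b. ?D (m - b))" if "a \<subseteq># m" "b \<subseteq># a" for a b
      using that by (intro image_eqI[of _ _ "(b, a - b)"]) (auto simp: mset_subset_eq_exists_conv)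
    moreover have "b + c \<subseteq># m" if "b \<subseteq># m" "c \<subseteq># m - b" for b c
      using that by (auto simp: mset_subset_eq_exists_conv)
    ultimately show ?thesis
      by auto
  qed
  have inj: "inj_on ?j X" for X :: "('i multiset \<times> 'i multiset) set"
    by (auto simp: inj_on_def)
  have "(f \<otimes>\<^bsub>S\<^esub> g \<otimes>\<^bsub>S\<^esub> h) m
      = (\<Oplus>a\<in>?D m. \<Oplus>b\<in>?D a. f b \<otimes> g (a - b) \<otimes> h (m - a))"
    unfolding coeff_mult using assms
    by (intro finsum_cong') (auto intro!: finsum_ldistr finite_submultisets finsum_closed)
  also have "\<dots> = (\<Oplus>x\<in>Sigma (?D m) ?D. f (snd x) \<otimes> g (fst x - snd x) \<otimes> h (m - fst x))"
    using assms by (intro finsum_Sigma finite_submultisets) auto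
  also have "\<dots> = (\<Oplus>x\<in>Sigma (?D m) (\<lambda>b. ?D (m - b)).
        f (fst x) \<otimes> (g (snd x) \<otimes> h (m - fst x - snd x)))"
    unfolding img using assms
    by (subst finsum_reindex[OF _ inj])
      (auto intro!: finsum_cong' simp: m_assoc)
  also have "\<dots> = (\<Oplus>b\<in>?D m. \<Oplus>c\<in>?D (m - b). f b \<otimes> (g c \<otimes> h (m - b - c)))"
    using assms by (intro finsum_Sigma[symmetric] finite_submultisets) auto
  also have "\<dots> = (f \<otimes>\<^bsub>S\<^esub> (g \<otimes>\<^bsub>S\<^esub> h)) m"
    unfolding coeff_mult using assms
    by (intro finsum_cong') (auto intro!: finsum_rdistr[symmetric] finite_submultisets finsum_closed)
  finally show "(f \<otimes>\<^bsub>S\<^esub> g \<otimes>\<^bsub>S\<^esub> h) m = (f \<otimes>\<^bsub>S\<^esub> (g \<otimes>\<^bsub>S\<^esub> h)) m" .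
qed

lemma coeff_monomial_mult:
  assumes "f \<in> carrier S"
  shows "(monomial K b \<otimes>\<^bsub>S\<^esub> f) m = (if b \<subseteq># m then f (m - b) else \<zero>)"
proof -
  have "(monomial K b \<otimes>\<^bsub>S\<^esub> f) m = (\<Oplus>a\<in>{a. a \<subseteq># m}. if a = b then f (m - a) else \<zero>)"
    unfolding coeff_mult using assms by (intro finsum_cong') (auto simp: coeff_monomial)
  also have "\<dots> = (if b \<subseteq># m then f (m - b) else \<zero>)"
  proof (cases "b \<subseteq># m")
    case True
    then show ?thesis
      using assms add.finprod_singleton_swap[of b "{a. a \<subseteq># m}" "\<lambda>a. f (m - a)"]
      by (simp add: finite_submultisets Pi_def)
  next
    case False
    then show ?thesis
      by (auto intro!: add.finprod_one_eqI)
  qed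
  finally show ?thesis .
qed

sublocale PS: cring S
proof (rule cringI)
  show "abelian_group S"
  proof (rule abelian_groupI)
    fix f assume f: "f \<in> carrier S"
    show "\<exists>g\<in>carrier S. g \<oplus>\<^bsub>S\<^esub> f = \<zero>\<^bsub>S\<^esub>"
    proof (rule bexI)
      show "(\<lambda>m. \<ominus> f m) \<in> carrier S"
        using f by (simp add: series_carrier_iff)
      show "(\<lambda>m. \<ominus> f m) \<oplus>\<^bsub>S\<^esub> f = \<zero>\<^bsub>S\<^esub>"
        using f by (auto simp: fun_eq_iff l_neg)
    qed
  qed (auto simp: series_carrier_iff fun_eq_iff a_ac)
  show "comm_monoid S"
  proof (rule comm_monoidI)
    fix f assume "f \<in> carrier S"
    then show "\<one>\<^bsub>S\<^esub> \<otimes>\<^bsub>S\<^esub> f = f"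
      by (simp add: fun_eq_iff one_series coeff_monomial_mult)
  qed (auto simp: series_mult_closed series_m_assoc one_series intro: series_m_comm)
  fix f g h assume "f \<in> carrier S" "g \<in> carrier S" "h \<in> carrier S"
  then show "(f \<oplus>\<^bsub>S\<^esub> g) \<otimes>\<^bsub>S\<^esub> h = f \<otimes>\<^bsub>S\<^esub> h \<oplus>\<^bsub>S\<^esub> g \<otimes>\<^bsub>S\<^esub> h"
    by (auto simp: fun_eq_iff coeff_mult l_distr finsum_addf Pi_def)
qed

lemma coeff_uminus [simp]: "f \<in> carrier S \<Longrightarrow> (\<ominus>\<^bsub>S\<^esub> f) m = \<ominus> f m"
  using fun_cong[OF PS.l_neg, of f m] by (simp add: sum_zero_eq_neg)

lemma coeff_minus [simp]:
  "f \<in> carrier S \<Longrightarrow> g \<in> carrier S \<Longrightarrow> (f \<ominus>\<^bsub>S\<^esub> g) m = f m \<ominus> g m"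
  by (simp add: a_minus_def)

lemma coeff_finsum:
  assumes "finite A" "F \<in> A \<rightarrow> carrier S"
  shows "(\<Oplus>\<^bsub>S\<^esub>x\<in>A. F x) m = (\<Oplus>x\<in>A. F x m)"
  using assms by (induction A rule: finite_induct) (auto simp: Pi_def)

lemma monomial_add:
  assumes "set_mset a \<subseteq> V" "set_mset b \<subseteq> V"
  shows "monomial K (a + b) = monomial K a \<otimes>\<^bsub>S\<^esub> monomial K b"
  using assms
  by (auto simp: fun_eq_iff coeff_monomial_mult coeff_monomial dest: subset_mset.add_diff_inverse)

lemma coeff_mult_eq_zero:
  assumes "f \<in> carrier S" "g \<in> carrier S" "\<And>a b. m = a + b \<Longrightarrow> f a = \<zero> \<or> g b = \<zero>"
  shows "(f \<otimes>\<^bsub>S\<^esub> g) m = \<zero>"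
  unfolding coeff_mult
proof (rule add.finprod_one_eqI)
  fix a assume "a \<in> {a. a \<subseteq># m}"
  then show "f a \<otimes> g (m - a) = \<zero>"
    using assms(1,2) assms(3)[of a "m - a"] by auto
qed

end

section \<open>Orders on monomials\<close>

text \<open>
  Mapping the variables to distinct primes turns a monomial into a positive integer, and by unique
  factorisation no monomial is lost. Comparison of these integers serves as monomial order.
\<close>

lemma ex_multiplicative_rank:
  assumes "finite V"
  shows "\<exists>r :: 'i multiset \<Rightarrow> nat. (\<forall>a b. r (a + b) = r a * r b) \<and> (\<forall>a. 0 < r a) \<and>
    inj_on r {m. set_mset m \<subseteq> V}"
proof -
  obtain e :: "'i \<Rightarrow> nat" where e: "inj_on e V"
    using finite_imp_inj_to_nat_seg[OF assms] by blast
  define p where "p i = enumerate {q :: nat. prime q} (e i)" for i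
  have prime_p: "prime (p i)" for i
    using enumerate_in_set[OF primes_infinite] unfolding p_def by blast
  have inj_p: "inj_on p V"
    using e injD[OF inj_enumerate[OF primes_infinite]] unfolding inj_on_def p_def by blast
  define r where "r m = prod_mset (image_mset p m)" for m
  have "p i \<noteq> 0" for i
    using prime_p[of i] by (metis not_prime_0)
  then have "0 < r m" for m
    by (metis (no_types, lifting) gr0I image_iff multiset.set_map prod_mset_zero_iff r_def)
  moreover have "inj_on r {m. set_mset m \<subseteq> V}"
  proof (rule inj_on_inverseI)
    fix m assume "m \<in> {m. set_mset m \<subseteq> V}"
    then have m: "i \<in> V" if "i \<in># m" for i
      using that by auto
    have "prime_factorization (r m) = image_mset p m"
      unfolding r_def using prime_p by (intro prime_factorization_prod_mset_primes) auto
    then have "image_mset (the_inv_into V p) (prime_factorization (r m))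
        = image_mset (\<lambda>i. the_inv_into V p (p i)) m"
      by (simp add: image_mset.compositionality comp_def)
    also have "\<dots> = image_mset (\<lambda>i. i) m"
      using m inj_p by (intro image_mset_cong) (simp add: the_inv_into_f_f)
    finally show "image_mset (the_inv_into V p) (prime_factorization (r m)) = m"
      by simp
  qed
  ultimately show ?thesis
    by (intro exI[of _ r]) (simp add: r_def)
qed

definition monomial_rank :: "'i set \<Rightarrow> 'i multiset \<Rightarrow> nat"
  where "monomial_rank V = (SOME r. (\<forall>a b. r (a + b) = r a * r b) \<and> (\<forall>a. 0 < r a) \<and>
    inj_on r {m. set_mset m \<subseteq> V})"

lemma
  assumes "finite V"
  shows monomial_rank_add: "monomial_rank V (a + b) = monomial_rank V a * monomial_rank V b"
    and monomial_rank_pos: "0 < monomial_rank V a"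
    and inj_on_monomial_rank: "inj_on (monomial_rank V) {m. set_mset m \<subseteq> V}"
  using someI_ex[OF ex_multiplicative_rank[OF assms]] unfolding monomial_rank_def by blast+

text \<open>
  A monotone subsequence exists in general; over the natural numbers a decreasing one is constant from
  some point on, so that its tail is increasing as well.
\<close>

lemma ex_mono_subseq_nat:
  fixes g :: "nat \<Rightarrow> nat"
  shows "\<exists>f. strict_mono (f :: nat \<Rightarrow> nat) \<and> mono (\<lambda>n. g (f n))"
proof -
  obtain f :: "nat \<Rightarrow> nat" where f: "strict_mono f" "monoseq (\<lambda>n. g (f n))"
    using seq_monosub[of g] by blast
  show ?thesis
  proof (cases "mono (\<lambda>n. g (f n))")
    case True
    with f show ?thesis by blast
  next
    case False
    with f have dec: "g (f n) \<le> g (f m)" if "m \<le> n" for m n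
      using that by (auto simp: monoseq_iff decseq_def)
    obtain N where N: "\<And>n. g (f N) \<le> g (f n)"
      using ex_has_least_nat[of "\<lambda>_. True" 0 "\<lambda>n. g (f n)"] by blast
    have "g (f (n + N)) = g (f N)" for n
      using dec[of N "n + N"] N[of "n + N"] by simp
    moreover have "strict_mono (\<lambda>n. f (n + N))"
      using f(1) by (simp add: strict_mono_def)
    ultimately show ?thesis
      by (intro exI[of _ "\<lambda>n. f (n + N)"]) (simp add: mono_def)
  qed
qed

lemma ex_mono_subseq_family:
  fixes c :: "'a \<Rightarrow> nat \<Rightarrow> nat"
  assumes "finite W"
  shows "\<exists>f. strict_mono (f :: nat \<Rightarrow> nat) \<and> (\<forall>w\<in>W. mono (\<lambda>n. c w (f n)))"
  using assms
proof (induction W rule: finite_induct)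
  case empty
  have "strict_mono (\<lambda>n :: nat. n)"
    by (simp add: strict_mono_def)
  then show ?case
    by blast
next
  case (insert w W)
  then obtain f :: "nat \<Rightarrow> nat" where f: "strict_mono f" "\<And>v. v \<in> W \<Longrightarrow> mono (\<lambda>n. c v (f n))"
    by blast
  obtain g :: "nat \<Rightarrow> nat" where g: "strict_mono g" "mono (\<lambda>n. c w (f (g n)))"
    using ex_mono_subseq_nat[of "\<lambda>n. c w (f n)"] by blast
  have "mono (\<lambda>n. c v (f (g n)))" if "v \<in> W" for v
    using f(2)[OF that] strict_mono_mono[OF g(1)] by (auto simp: mono_def)
  moreover have "strict_mono (\<lambda>n. f (g n))"
    using f(1) g(1) by (simp add: strict_mono_def)
  ultimately show ?case
    using g(2) by (intro exI[of _ "\<lambda>n. f (g n)"]) simp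
qed

text \<open>
  The minimal elements of \<open>U\<close> form an antichain. If there were infinitely many, a sequence of them would
  have a subsequence along which every exponent increases, with two comparable members.
\<close>

lemma dickson:
  assumes "finite V" and "U \<subseteq> {m. set_mset m \<subseteq> V}"
  shows "\<exists>B \<subseteq> U. finite B \<and> (\<forall>m\<in>U. \<exists>b\<in>B. b \<subseteq># m)"
proof -
  define B where "B = {b \<in> U. \<forall>a\<in>U. a \<subseteq># b \<longrightarrow> a = b}"
  have "finite B"
  proof (rule ccontr)
    assume "infinite B"
    then obtain s :: "nat \<Rightarrow> 'a multiset" where s: "inj s" "range s \<subseteq> B"
      using infinite_countable_subset by blast
    obtain f :: "nat \<Rightarrow> nat" where f: "strict_mono f" "\<And>v. v \<in> V \<Longrightarrow> mono (\<lambda>n. count (s (f n)) v)"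
      using ex_mono_subseq_family[OF assms(1), of "\<lambda>v n. count (s n) v"] by blast
    have over: "set_mset (s n) \<subseteq> V" for n
      using s(2) assms(2) by (auto simp: B_def)
    have "s (f 0) \<subseteq># s (f 1)"
    proof (rule mset_subset_eqI)
      fix v
      show "count (s (f 0)) v \<le> count (s (f 1)) v"
      proof (cases "v \<in> V")
        case True
        with f(2) show ?thesis by (simp add: mono_def)
      next
        case False
        with over[of "f 0"] have "count (s (f 0)) v = 0"
          by (meson not_in_iff subset_iff)
        then show ?thesis by simp
      qed
    qed
    moreover have "s (f 0) \<in> B" "s (f 1) \<in> B"
      using s(2) by auto
    ultimately have "f 0 = f 1"
      using s(1) by (auto simp: B_def inj_def)
    with f(1) show False
      by (metis strict_mono_eq zero_neq_one)
  qed
  moreover have "\<exists>b\<in>B. b \<subseteq># m" if "m \<in> U" for m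
    using that
  proof (induction "size m" arbitrary: m rule: less_induct)
    case less
    show ?case
    proof (cases "m \<in> B")
      case False
      with less(2) obtain a where a: "a \<in> U" "a \<subseteq># m" "a \<noteq> m"
        by (auto simp: B_def)
      then have "a \<subset># m"
        by (simp add: subset_mset.less_le)
      then have "size a < size m"
        by (rule mset_subset_size)
      with less(1) a show ?thesis
        by (meson subset_mset.trans)
    qed auto
  qed
  ultimately show ?thesis
    by (intro exI[of _ B]) (auto simp: B_def)
qed

section \<open>Leading monomials and division\<close>

locale power_series_field = power_series K V + field K
  for K :: "('k, 'b) ring_scheme" (structure) and V :: "'i set" +
  assumes finite_V: "finite V"
begin

abbreviation rank :: "'i multiset \<Rightarrow> nat"
  where "rank \<equiv> monomial_rank V"

lemmas rank_add = monomial_rank_add[OF finite_V]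
  and rank_pos = monomial_rank_pos[OF finite_V]
  and rank_inj = inj_onD[OF inj_on_monomial_rank[OF finite_V]]

text \<open>
  As for local monomial orders, the leading monomial is the least one: a power series has no greatest one.
\<close>

definition lead :: "('i multiset \<Rightarrow> 'k) \<Rightarrow> 'i multiset"
  where "lead f = (ARG_MIN rank m. f m \<noteq> \<zero>)"

lemma ex_coeff_nonzero:
  assumes "f \<in> carrier S" "f \<noteq> \<zero>\<^bsub>S\<^esub>"
  shows "\<exists>m. f m \<noteq> \<zero>"
proof (rule ccontr)
  assume "\<not> (\<exists>m. f m \<noteq> \<zero>)"
  then have "f = \<zero>\<^bsub>S\<^esub>"
    by (simp add: fun_eq_iff)
  with assms(2) show False ..
qed

lemma
  assumes "f m \<noteq> \<zero>"
  shows coeff_lead: "f (lead f) \<noteq> \<zero>"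
    and rank_lead_le: "rank (lead f) \<le> rank m"
  using arg_min_nat_lemma[of "\<lambda>m. f m \<noteq> \<zero>" m rank] assms by (auto simp: lead_def)

lemma lead_in_monomials:
  assumes "f \<in> carrier S" "f m \<noteq> \<zero>"
  shows "set_mset (lead f) \<subseteq> V"
  using coeff_lead[of f m] coeff_outside[OF assms(1)] assms(2) by blast

lemma lead_const:
  assumes "f {#} \<noteq> \<zero>" "f \<in> carrier S"
  shows "lead f = {#}"
proof -
  have "rank (a + {#}) = rank a * rank {#}" for a
    by (rule rank_add)
  from this[of "{#}"] rank_pos[of "{#}"] have "rank {#} = 1"
    by simp
  with rank_lead_le[of f "{#}"] assms rank_pos[of "lead f"] have "rank (lead f) = rank {#}"
    by simp
  with lead_in_monomials[OF assms(2,1)] show ?thesis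
    by (intro rank_inj) auto
qed

text \<open>
  Division by \<open>F\<close> in infinitely many steps. Every monomial \<open>m\<close> divisible by a leading monomial of \<open>F\<close> is
  the leading monomial of a multiple \<open>e m\<close> of some member of \<open>F\<close>. Given \<open>h\<close> in \<open>J\<close>, there are coefficients
  \<open>c m\<close> such that \<open>h\<close> and the sum of all \<open>c m * e m\<close> agree at these monomials: the equations form a
  triangular system with respect to the rank. Collecting the terms that belong to the same member of
  \<open>F\<close> shows that the sum lies in the ideal generated by \<open>F\<close>. The difference from \<open>h\<close> lies in \<open>J\<close>, but none of
  its monomials can be its leading one, so it vanishes.
\<close>

lemma ideal_eq_genideal_lead:
  assumes J: "ideal J S" and F: "finite F" "F \<subseteq> J" "\<zero>\<^bsub>S\<^esub> \<notin> F"
    and lead_F: "\<And>h. h \<in> J \<Longrightarrow> h \<noteq> \<zero>\<^bsub>S\<^esub> \<Longrightarrow> \<exists>f\<in>F. lead f \<subseteq># lead h"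
  shows "J = Idl\<^bsub>S\<^esub> F"
proof
  interpret J: ideal J S by fact
  have F_carrier: "f \<in> carrier S" if "f \<in> F" for f
    using that F(2) J.a_subset by blast
  have F_lead: "f (lead f) \<noteq> \<zero>" "set_mset (lead f) \<subseteq> V" if f: "f \<in> F" for f
  proof -
    have "f \<noteq> \<zero>\<^bsub>S\<^esub>"
      using f F(3) by blast
    then obtain m where "f m \<noteq> \<zero>"
      using ex_coeff_nonzero F_carrier[OF f] by blast
    then show "f (lead f) \<noteq> \<zero>" "set_mset (lead f) \<subseteq> V"
      using coeff_lead lead_in_monomials F_carrier[OF f] by blast+
  qed
  show "Idl\<^bsub>S\<^esub> F \<subseteq> J"
    using J F(2) by (rule PS.genideal_minimal)
  show "J \<subseteq> Idl\<^bsub>S\<^esub> F"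
  proof
    fix h assume h: "h \<in> J"
    then have h_carrier: "h \<in> carrier S"
      by (rule J.Icarr)
    define M where "M = {m \<in> monomials. \<exists>f\<in>F. lead f \<subseteq># m}"
    obtain d where d: "\<And>m. m \<in> M \<Longrightarrow> d m \<in> F" "\<And>m. m \<in> M \<Longrightarrow> lead (d m) \<subseteq># m"
    proof -
      have "\<forall>m\<in>M. \<exists>f. f \<in> F \<and> lead f \<subseteq># m"
        by (auto simp: M_def)
      from bchoice[OF this] that show thesis
        by blast
    qed
    (* The multiple of a member of F that has leading monomial m is e m = monomial (q m) * d m. *)
    define q where "q m = m - lead (d m)" for m
    have q: "q m + lead (d m) = m" if "m \<in> M" for m
      using d(2)[OF that] by (simp add: q_def)
    (* The m for which e m can have a term at x; its coefficient there is d m (x - q m). *)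
    define N where "N x = {m \<in> M. q m \<subseteq># x}" for x
    have N_subset: "N x \<subseteq> (\<lambda>(f, a). a + lead f) ` (F \<times> {a. a \<subseteq># x})" for x
      using q d(1) by (force simp: N_def intro!: image_eqI[of _ _ "(d _, q _)"])
    have finite_N: "finite (N x)" for x
      by (rule finite_subset[OF N_subset]) (simp add: F(1) finite_submultisets)
    have d_closed: "d m y \<in> carrier K" if "m \<in> M" for m y
      using coeff_closed[OF F_carrier[OF d(1)[OF that]]] .
    (* Triangularity: e m contributes to x only if m = x or m has smaller rank than x. *)
    have later: "d m (x - q m) = \<zero>" if m: "m \<in> N x" "m \<noteq> x" "\<not> rank m < rank x" for m x
    proof (rule ccontr)
      assume nz: "d m (x - q m) \<noteq> \<zero>"
      from m have mM: "m \<in> M" and "q m \<subseteq># x"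
        by (auto simp: N_def)
      have "set_mset (x - q m) \<subseteq> V"
        using nz coeff_outside[OF F_carrier[OF d(1)[OF mM]]] by blast
      moreover have "set_mset (q m) \<subseteq> V"
        using q[OF mM] mM by (auto simp: M_def q_def dest: in_diffD)
      moreover have x: "x = q m + (x - q m)"
        using \<open>q m \<subseteq># x\<close> by simp
      ultimately have "x \<in> monomials"
        by (metis (mono_tags, lifting) Un_least mem_Collect_eq set_mset_union)
      with mM m(2) have "rank m \<noteq> rank x"
        using rank_inj[of m x] by (auto simp: M_def)
      with m(3) have "rank x < rank m"
        by simp
      moreover have "rank (lead (d m)) \<le> rank (x - q m)"
        using nz by (rule rank_lead_le)
      then have "rank m \<le> rank x"
        by (metis q[OF mM] x rank_add mult_le_mono2)
      ultimately show False
        by simp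
    qed
    define lower where "lower c x = (\<Oplus>m\<in>{m \<in> N x. rank m < rank x}. c m \<otimes> d m (x - q m))"
      for c x
    obtain c where c: "\<And>x. c x \<in> carrier K"
      "\<And>x. x \<in> M \<Longrightarrow> h x = c x \<otimes> d x (lead (d x)) \<oplus> lower c x"
    proof -
      (* P c x y: the value y at x solves the equation at x, given the values of c at smaller ranks.
         These are required to lie in K only inside P, since c is arbitrary in the recursion principle. *)
      define P where "P c x y \<longleftrightarrow> y \<in> carrier K \<and> (x \<in> M \<longrightarrow> (\<forall>z. rank z < rank x \<longrightarrow> c z \<in> carrier K) \<longrightarrow>
          h x = y \<otimes> d x (lead (d x)) \<oplus> lower c x)" for c x y
      have "\<exists>c. \<forall>x. P c x (c x)"
      proof (rule dependent_wf_choice[of "measure rank"])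
        fix c c' :: "'i multiset \<Rightarrow> 'k" and x y
        assume "\<And>z. (z, x) \<in> measure rank \<Longrightarrow> c z = c' z"
        then have *: "\<And>z. rank z < rank x \<Longrightarrow> c z = c' z"
          by simp
        have "lower c x = lower c' x" if "\<forall>z. rank z < rank x \<longrightarrow> c' z \<in> carrier K"
          unfolding lower_def using * that d_closed
          by (intro finsum_cong') (auto simp: N_def)
        with * show "P c x y = P c' x y"
          by (auto simp: P_def)
      next
        fix x c assume "\<And>y. (y, x) \<in> measure rank \<Longrightarrow> P c y (c y)"
        then have cc: "\<And>y. rank y < rank x \<Longrightarrow> c y \<in> carrier K"
          by (simp add: P_def)
        show "\<exists>y. P c x y"
        proof (cases "x \<in> M")
          case True
          define l where "l = d x (lead (d x))"
          define y where "y = (h x \<ominus> lower c x) \<otimes> inv l"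
          have l: "l \<in> Units K"
            using F_lead(1)[OF d(1)[OF True]] d_closed[OF True] by (simp add: l_def field_Units)
          have low: "lower c x \<in> carrier K"
            unfolding lower_def using cc d_closed by (intro finsum_closed) (auto simp: N_def)
          have "y \<otimes> l \<oplus> lower c x = h x"
            unfolding y_def using low l h_carrier
            by (simp add: m_assoc Units_closed a_minus_def a_assoc l_neg)
          moreover have "y \<in> carrier K"
            using low l h_carrier by (simp add: y_def)
          ultimately show ?thesis
            by (auto simp: P_def l_def intro!: exI[of _ y])
        next
          case False
          then show ?thesis
            by (auto simp: P_def)
        qed
      qed simp
      then obtain c where "\<And>x. P c x (c x)"
        by blast
      then show thesis
        by (intro that[of c]) (auto simp: P_def)
    qed
    (* The cofactor of f collects the coefficients of those e m that are multiples of f. *)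
    define g where "g f a = (if a + lead f \<in> M \<and> d (a + lead f) = f then c (a + lead f) else \<zero>)"
      for f a
    have g_closed: "g f \<in> carrier S" for f
      using c(1) by (auto simp: g_def series_carrier_iff M_def)
    define t where "t = (\<Oplus>\<^bsub>S\<^esub>f\<in>F. g f \<otimes>\<^bsub>S\<^esub> f)"
    have t_closed: "t \<in> carrier S"
      unfolding t_def using g_closed F_carrier by (intro PS.finsum_closed) auto
    have coeff_t: "t x = (\<Oplus>m\<in>N x. c m \<otimes> d m (x - q m))" for x
    proof -
      let ?e = "\<lambda>m. (d m, q m)"
      have inj: "inj_on ?e (N x)"
      proof (rule inj_onI)
        fix m m' assume "m \<in> N x" "m' \<in> N x" "?e m = ?e m'"
        then show "m = m'"
          using q[of m] q[of m'] unfolding N_def by (metis (no_types, lifting) mem_Collect_eq prod.inject)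
      qed
      have sub: "?e ` N x \<subseteq> F \<times> {a. a \<subseteq># x}"
        using d(1) by (auto simp: N_def)
      have "t x = (\<Oplus>f\<in>F. \<Oplus>a\<in>{a. a \<subseteq># x}. g f a \<otimes> f (x - a))"
        unfolding t_def using g_closed F_carrier F(1)
        by (subst coeff_finsum) (auto simp: coeff_mult)
      also have "\<dots> = (\<Oplus>y\<in>F \<times> {a. a \<subseteq># x}. g (fst y) (snd y) \<otimes> fst y (x - snd y))"
        using g_closed F_carrier F(1)
        by (intro finsum_Sigma[of F "\<lambda>_. {a. a \<subseteq># x}"]) (auto simp: finite_submultisets)
      also have "\<dots> = (\<Oplus>y\<in>?e ` N x. g (fst y) (snd y) \<otimes> fst y (x - snd y))"
      proof (rule add.finprod_mono_neutral_cong_right)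
        show "finite (F \<times> {a. a \<subseteq># x})"
          by (simp add: F(1) finite_submultisets)
        show "(\<lambda>y. g (fst y) (snd y) \<otimes> fst y (x - snd y)) \<in> F \<times> {a. a \<subseteq># x} \<rightarrow> carrier K"
          using g_closed F_carrier by auto
        fix y assume y: "y \<in> F \<times> {a. a \<subseteq># x} - ?e ` N x"
        obtain f a where fa: "y = (f, a)"
          by (cases y)
        have "g f a = \<zero>"
        proof (rule ccontr)
          assume "g f a \<noteq> \<zero>"
          then have m: "a + lead f \<in> M" "d (a + lead f) = f"
            by (auto simp: g_def split: if_splits)
          then have "q (a + lead f) = a"
            by (simp add: q_def)
          with m y fa have "y \<in> ?e ` N x"
            by (intro image_eqI[of _ _ "a + lead f"]) (auto simp: N_def)
          with y show False by simp
        qed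
        then show "g (fst y) (snd y) \<otimes> fst y (x - snd y) = \<zero>"
          using y fa F_carrier by auto
      qed (use sub in auto)
      also have "\<dots> = (\<Oplus>m\<in>N x. g (d m) (q m) \<otimes> d m (x - q m))"
        using g_closed sub F_carrier inj by (subst finsum_reindex) (auto simp: Pi_def)
      also have "\<dots> = (\<Oplus>m\<in>N x. c m \<otimes> d m (x - q m))"
        using c(1) d_closed q by (intro finsum_cong') (auto simp: N_def g_def)
      finally show ?thesis .
    qed
    have "t x = h x" if x: "x \<in> M" for x
    proof -
      have xN: "x \<in> N x"
        using x by (simp add: N_def q_def)
      have x_q: "x - q x = lead (d x)"
        using q[OF x] by (metis add_diff_cancel_left')
      have "t x = (\<Oplus>m\<in>insert x {m \<in> N x. rank m < rank x}. c m \<otimes> d m (x - q m))"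
        unfolding coeff_t using c(1) d_closed xN later
        by (intro add.finprod_mono_neutral_cong_right finite_N) (auto simp: N_def)
      also have "\<dots> = c x \<otimes> d x (x - q x) \<oplus> lower c x"
      proof -
        have "finite {m \<in> N x. rank m < rank x}"
          using finite_N by simp
        then show ?thesis
          unfolding lower_def using c(1) d_closed x by (subst finsum_insert) (auto simp: N_def)
      qed
      finally show ?thesis
        using c(2)[OF x] x_q by simp
    qed
    then have agree: "(h \<ominus>\<^bsub>S\<^esub> t) x = \<zero>" if "x \<in> M" for x
      using that h_carrier t_closed by (simp add: r_neg a_minus_def)
    have ideal_F: "ideal (Idl\<^bsub>S\<^esub> F) S"
      using F_carrier by (intro PS.genideal_ideal) auto
    have t_Idl: "t \<in> Idl\<^bsub>S\<^esub> F"
    proof -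
      interpret I: ideal "Idl\<^bsub>S\<^esub> F" S by (rule ideal_F)
      have mem: "g f \<otimes>\<^bsub>S\<^esub> f \<in> Idl\<^bsub>S\<^esub> F" if "f \<in> F" for f
        using that PS.genideal_self[of F] F_carrier g_closed by (intro I.I_l_closed) auto
      have "(\<Oplus>\<^bsub>S\<^esub>f\<in>G. g f \<otimes>\<^bsub>S\<^esub> f) \<in> Idl\<^bsub>S\<^esub> F" if "finite G" "G \<subseteq> F" for G
        using that
      proof (induction G rule: finite_induct)
        case empty
        show ?case
          unfolding PS.finsum_empty by (rule I.zero_closed)
      next
        case (insert f G)
        have "(\<Oplus>\<^bsub>S\<^esub>f\<in>insert f G. g f \<otimes>\<^bsub>S\<^esub> f) = g f \<otimes>\<^bsub>S\<^esub> f \<oplus>\<^bsub>S\<^esub> (\<Oplus>\<^bsub>S\<^esub>f\<in>G. g f \<otimes>\<^bsub>S\<^esub> f)"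
          using insert g_closed F_carrier by (intro PS.finsum_insert) auto
        with I.a_closed[OF mem, of f] insert show ?case
          by (simp only: insert_subset)
      qed
      then show ?thesis
        using F(1) by (simp add: t_def)
    qed
    have "t \<in> J"
      using t_Idl PS.genideal_minimal[OF J F(2)] by blast
    with h have hJ: "h \<ominus>\<^bsub>S\<^esub> t \<in> J"
      by (simp add: a_minus_def J.a_closed J.a_inv_closed)
    have "h \<ominus>\<^bsub>S\<^esub> t = \<zero>\<^bsub>S\<^esub>"
    proof (rule ccontr)
      assume nz: "h \<ominus>\<^bsub>S\<^esub> t \<noteq> \<zero>\<^bsub>S\<^esub>"
      then obtain m where "(h \<ominus>\<^bsub>S\<^esub> t) m \<noteq> \<zero>"
        using ex_coeff_nonzero J.Icarr[OF hJ] by blast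
      then have "(h \<ominus>\<^bsub>S\<^esub> t) (lead (h \<ominus>\<^bsub>S\<^esub> t)) \<noteq> \<zero>"
        and "set_mset (lead (h \<ominus>\<^bsub>S\<^esub> t)) \<subseteq> V"
        using coeff_lead lead_in_monomials J.Icarr[OF hJ] by blast+
      moreover have "\<exists>f\<in>F. lead f \<subseteq># lead (h \<ominus>\<^bsub>S\<^esub> t)"
        using lead_F[OF hJ nz] .
      ultimately show False
        using agree by (auto simp: M_def)
    qed
    then have "h = t"
      using h_carrier t_closed by (simp add: PS.r_right_minus_eq)
    with t_Idl show "h \<in> Idl\<^bsub>S\<^esub> F"
      by simp
  qed
qed

text \<open>
  By Dickson's lemma every leading monomial of a member of \<open>J\<close> is divisible by one of finitely many.
\<close>

theorem noetherian: "noetherian_ring S"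
proof (rule PS.noetherian_ringI)
  fix J assume J: "ideal J S"
  then have carr: "J \<subseteq> carrier S"
    by (simp add: additive_subgroup.a_subset ideal.axioms(1))
  define L where "L = lead ` (J - {\<zero>\<^bsub>S\<^esub>})"
  have "L \<subseteq> monomials"
  proof
    fix a assume "a \<in> L"
    then obtain f where f: "f \<in> J" "f \<noteq> \<zero>\<^bsub>S\<^esub>" "a = lead f"
      by (auto simp: L_def)
    with carr obtain m where "f m \<noteq> \<zero>"
      using ex_coeff_nonzero by blast
    with f carr show "a \<in> monomials"
      using lead_in_monomials[of f m] by blast
  qed
  from dickson[OF finite_V this] obtain B where
    B: "B \<subseteq> L" "finite B" "\<And>m. m \<in> L \<Longrightarrow> \<exists>b\<in>B. b \<subseteq># m"
    by blast
  obtain F where F: "F \<subseteq> J - {\<zero>\<^bsub>S\<^esub>}" "finite F" "B = lead ` F"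
    using finite_subset_image[OF B(2) B(1)[unfolded L_def]] by blast
  have "J = Idl\<^bsub>S\<^esub> F"
  proof (rule ideal_eq_genideal_lead[OF J F(2)])
    fix h assume "h \<in> J" "h \<noteq> \<zero>\<^bsub>S\<^esub>"
    then have "lead h \<in> L"
      by (simp add: L_def)
    with B(3) F(3) show "\<exists>f\<in>F. lead f \<subseteq># lead h"
      by blast
  qed (use F in auto)
  with F carr show "\<exists>F\<subseteq>carrier S. finite F \<and> J = Idl\<^bsub>S\<^esub> F"
    by blast
qed

text \<open>
  Such an \<open>f\<close> has leading monomial 1, so every series can be divided by \<open>f\<close>. In particular \<open>f\<close> is a unit.
\<close>

lemma ideal_nonzero_const_eq_carrier:
  assumes J: "ideal J S" and f: "f \<in> J" "f {#} \<noteq> \<zero>"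
  shows "J = carrier S"
proof -
  have fS: "f \<in> carrier S"
    using ideal.Icarr[OF J f(1)] .
  have "carrier S = Idl\<^bsub>S\<^esub> {f}"
    using f fS by (intro ideal_eq_genideal_lead PS.oneideal) (auto simp: lead_const)
  also have "\<dots> \<subseteq> J"
    using f by (intro PS.genideal_minimal J) simp
  finally show ?thesis
    using ideal.Icarr[OF J] by blast
qed

end

section \<open>Monomial ideals\<close>

definition upward_closed :: "'i multiset set \<Rightarrow> bool"
  where "upward_closed U \<longleftrightarrow> (\<forall>m\<in>U. \<forall>a. m \<subseteq># a \<longrightarrow> a \<in> U)"

lemma upward_closedI: "(\<And>m a. m \<in> U \<Longrightarrow> m \<subseteq># a \<Longrightarrow> a \<in> U) \<Longrightarrow> upward_closed U"
  by (simp add: upward_closed_def)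

lemma upward_closedD: "upward_closed U \<Longrightarrow> m \<in> U \<Longrightarrow> m \<subseteq># a \<Longrightarrow> a \<in> U"
  by (simp add: upward_closed_def)

context power_series
begin

definition monomial_ideal :: "'i multiset set \<Rightarrow> ('i multiset \<Rightarrow> 'k) set"
  where "monomial_ideal U = {f \<in> carrier S. \<forall>m. m \<notin> U \<longrightarrow> f m = \<zero>}"

definition restrict_support :: "'i multiset set \<Rightarrow> ('i multiset \<Rightarrow> 'k) \<Rightarrow> 'i multiset \<Rightarrow> 'k"
  where "restrict_support U f = (\<lambda>m. if m \<in> U then f m else \<zero>)"

lemma restrict_support_closed [simp]: "f \<in> carrier S \<Longrightarrow> restrict_support U f \<in> carrier S"
  by (auto simp: restrict_support_def series_carrier_iff)

lemma restrict_support_in_monomial_ideal: "f \<in> carrier S \<Longrightarrow> restrict_support U f \<in> monomial_ideal U"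
  by (simp add: monomial_ideal_def) (simp add: restrict_support_def)

lemma minus_restrict_support: "f \<in> carrier S \<Longrightarrow> f \<ominus>\<^bsub>S\<^esub> restrict_support U f = restrict_support (- U) f"
proof
  fix m assume f: "f \<in> carrier S"
  then have "(f \<ominus>\<^bsub>S\<^esub> restrict_support U f) m = f m \<ominus> restrict_support U f m"
    by (intro coeff_minus restrict_support_closed)
  with f show "(f \<ominus>\<^bsub>S\<^esub> restrict_support U f) m = restrict_support (- U) f m"
    by (simp add: restrict_support_def a_minus_def r_neg)
qed

lemma restrict_support_add_compl: "f \<in> carrier S \<Longrightarrow> f = restrict_support U f \<oplus>\<^bsub>S\<^esub> restrict_support (- U) f"
  by (auto simp: fun_eq_iff) (auto simp: restrict_support_def)

lemma ideal_monomial_ideal: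
  assumes U: "upward_closed U"
  shows "ideal (monomial_ideal U) S"
proof (rule idealI)
  show "ring S"
    by (rule PS.ring_axioms)
  show "subgroup (monomial_ideal U) (add_monoid S)"
  proof (rule PS.add.subgroupI)
    show "monomial_ideal U \<subseteq> carrier S"
      by (auto simp: monomial_ideal_def)
    show "monomial_ideal U \<noteq> {}"
      using restrict_support_in_monomial_ideal[of "\<zero>\<^bsub>S\<^esub>"] by auto
  qed (auto simp: monomial_ideal_def simp flip: a_inv_def)
  show left: "g \<otimes>\<^bsub>S\<^esub> f \<in> monomial_ideal U" if f: "f \<in> monomial_ideal U" and g: "g \<in> carrier S" for f g
  proof -
    have "(g \<otimes>\<^bsub>S\<^esub> f) m = \<zero>" if m: "m \<notin> U" for m
    proof (rule coeff_mult_eq_zero[OF g])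
      fix a b assume "m = a + b"
      then have "b \<notin> U"
        using m upward_closedD[OF U, of b m] by auto
      with f show "g a = \<zero> \<or> f b = \<zero>"
        by (simp add: monomial_ideal_def)
    qed (use f in \<open>simp add: monomial_ideal_def\<close>)
    with f g show ?thesis
      by (simp add: monomial_ideal_def)
  qed
  show "f \<otimes>\<^bsub>S\<^esub> g \<in> monomial_ideal U" if f: "f \<in> monomial_ideal U" and g: "g \<in> carrier S" for f g
    using left[OF f g] f g PS.m_comm[of f g] by (simp add: monomial_ideal_def)
qed

lemma monomial_in_monomial_ideal:
  "m \<in> U \<Longrightarrow> set_mset m \<subseteq> V \<Longrightarrow> monomial K m \<in> monomial_ideal U"
  by (auto simp: monomial_ideal_def coeff_monomial)

text \<open>
  A power series in a monomial ideal is a finite combination of the generators although its support is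
  infinite: the terms divisible by the first generator add up to a multiple of it, and the remaining
  terms are treated in the same way.
\<close>

lemma in_ideal_if_support_generated:
  assumes J: "ideal J S" and "finite B" and f: "f \<in> carrier S"
    and "\<And>m. f m \<noteq> \<zero> \<Longrightarrow> \<exists>b\<in>B. b \<subseteq># m \<and> monomial K b \<in> J"
  shows "f \<in> J"
  using assms(2-)
proof (induction B arbitrary: f rule: finite_induct)
  case empty
  interpret J: ideal J S by fact
  from empty have "f = \<zero>\<^bsub>S\<^esub>"
    by (auto simp: fun_eq_iff)
  then show ?case by (simp del: coeff_zero)
next
  case (insert b B)
  interpret J: ideal J S by fact
  have rest: "restrict_support (- {m. b \<subseteq># m \<and> monomial K b \<in> J}) f \<in> J"
    using insert by (intro insert.IH restrict_support_closed) (auto simp: restrict_support_def split: if_splits)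
  have "restrict_support {m. b \<subseteq># m \<and> monomial K b \<in> J} f \<in> J"
  proof (cases "monomial K b \<in> J")
    case True
    define g where "g m = (if set_mset b \<subseteq> V then f (m + b) else \<zero>)" for m
    have g: "g \<in> carrier S"
      using insert.prems(1) by (auto simp: g_def series_carrier_iff)
    have "restrict_support {m. b \<subseteq># m \<and> monomial K b \<in> J} f = monomial K b \<otimes>\<^bsub>S\<^esub> g"
    proof
      fix m
      have "f m = \<zero>" if "b \<subseteq># m" "\<not> set_mset b \<subseteq> V"
        using that insert.prems(1) by (intro coeff_outside) (auto dest: mset_subset_eqD)
      then show "restrict_support {m. b \<subseteq># m \<and> monomial K b \<in> J} f m = (monomial K b \<otimes>\<^bsub>S\<^esub> g) m"
        using True by (auto simp: coeff_monomial_mult[OF g] restrict_support_def g_def)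
    qed
    with J.I_r_closed[OF True g] show ?thesis
      by simp
  next
    case False
    then have "restrict_support {m. b \<subseteq># m \<and> monomial K b \<in> J} f = \<zero>\<^bsub>S\<^esub>"
      by (simp add: restrict_support_def fun_eq_iff)
    then show ?thesis
      by simp
  qed
  with rest J.a_closed restrict_support_add_compl[OF insert.prems(1)] show ?case
    by metis
qed

lemma monomial_ideal_eq_genideal:
  assumes U: "upward_closed U" and B: "finite B" "B \<subseteq> U \<inter> monomials"
    and gen: "\<And>m. m \<in> U \<inter> monomials \<Longrightarrow> \<exists>b\<in>B. b \<subseteq># m"
  shows "monomial_ideal U = Idl\<^bsub>S\<^esub> (monomial K ` B)"
proof
  have carr: "monomial K ` B \<subseteq> carrier S"
    using B by auto
  show "Idl\<^bsub>S\<^esub> (monomial K ` B) \<subseteq> monomial_ideal U"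
    using B by (intro PS.genideal_minimal ideal_monomial_ideal U) (auto intro!: monomial_in_monomial_ideal)
  show "monomial_ideal U \<subseteq> Idl\<^bsub>S\<^esub> (monomial K ` B)"
  proof
    fix f assume f: "f \<in> monomial_ideal U"
    show "f \<in> Idl\<^bsub>S\<^esub> (monomial K ` B)"
    proof (rule in_ideal_if_support_generated[OF PS.genideal_ideal[OF carr] B(1)])
      show "f \<in> carrier S"
        using f by (simp add: monomial_ideal_def)
      fix m assume "f m \<noteq> \<zero>"
      with f have "m \<in> U" "m \<in> monomials"
        by (auto simp: monomial_ideal_def series_carrier_iff)
      with gen PS.genideal_self[OF carr]
      show "\<exists>b\<in>B. b \<subseteq># m \<and> monomial K b \<in> Idl\<^bsub>S\<^esub> (monomial K ` B)"
        by blast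
    qed
  qed
qed

definition variable_ideal :: "'i set \<Rightarrow> ('i multiset \<Rightarrow> 'k) set"
  where "variable_ideal A = monomial_ideal {m. set_mset m \<inter> A \<noteq> {}}"

lemma upward_closed_meets: "upward_closed {m. set_mset m \<inter> A \<noteq> {}}"
  by (rule upward_closedI) (auto dest: mset_subset_eqD)

lemma ideal_variable_ideal: "ideal (variable_ideal A) S"
  unfolding variable_ideal_def by (rule ideal_monomial_ideal[OF upward_closed_meets])

lemma variable_ideal_iff:
  "f \<in> variable_ideal A \<longleftrightarrow> f \<in> carrier S \<and> (\<forall>m. set_mset m \<inter> A = {} \<longrightarrow> f m = \<zero>)"
  by (auto simp: variable_ideal_def monomial_ideal_def)

lemma variable_ideal_mono: "A \<subseteq> B \<Longrightarrow> variable_ideal A \<subseteq> variable_ideal B"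
  by (auto simp: variable_ideal_iff) blast

lemma variable_ideal_subset_iff_variables:
  assumes J: "ideal J S" and "finite A" "A \<subseteq> V"
  shows "variable_ideal A \<subseteq> J \<longleftrightarrow> (\<forall>i\<in>A. monomial K {#i#} \<in> J)"
proof
  assume "variable_ideal A \<subseteq> J"
  moreover have "monomial K {#i#} \<in> variable_ideal A" if "i \<in> A" for i
    unfolding variable_ideal_def using that assms(3) by (intro monomial_in_monomial_ideal) auto
  ultimately show "\<forall>i\<in>A. monomial K {#i#} \<in> J"
    by blast
next
  assume X: "\<forall>i\<in>A. monomial K {#i#} \<in> J"
  show "variable_ideal A \<subseteq> J"
  proof
    fix f assume f: "f \<in> variable_ideal A"
    show "f \<in> J"
    proof (rule in_ideal_if_support_generated[OF J, of "(\<lambda>i. {#i#}) ` A"])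
      fix m assume "f m \<noteq> \<zero>"
      with f obtain i where "i \<in># m" "i \<in> A"
        by (auto simp: variable_ideal_iff)
      with X show "\<exists>b\<in>(\<lambda>i. {#i#}) ` A. b \<subseteq># m \<and> monomial K b \<in> J"
        by auto
    qed (use f assms in \<open>auto simp: variable_ideal_iff\<close>)
  qed
qed

lemma set_add_variable_ideal:
  "variable_ideal A <+>\<^bsub>S\<^esub> variable_ideal B = variable_ideal (A \<union> B)"
proof
  interpret I: ideal "variable_ideal (A \<union> B)" S
    by (rule ideal_variable_ideal)
  show "variable_ideal A <+>\<^bsub>S\<^esub> variable_ideal B \<subseteq> variable_ideal (A \<union> B)"
    using variable_ideal_mono[of A "A \<union> B"] variable_ideal_mono[of B "A \<union> B"] I.a_closed
    by (auto simp: set_add_def')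
  show "variable_ideal (A \<union> B) \<subseteq> variable_ideal A <+>\<^bsub>S\<^esub> variable_ideal B"
  proof
    fix f assume f: "f \<in> variable_ideal (A \<union> B)"
    let ?U = "{m. set_mset m \<inter> A \<noteq> {}}"
    have fS: "f \<in> carrier S"
      using f by (simp add: variable_ideal_iff)
    have "restrict_support ?U f \<in> variable_ideal A"
      unfolding variable_ideal_def by (rule restrict_support_in_monomial_ideal[OF fS])
    moreover have "restrict_support (- ?U) f \<in> variable_ideal B"
      using f restrict_support_closed[OF fS, of "- ?U"] unfolding variable_ideal_iff
      by (simp add: restrict_support_def) blast
    ultimately show "f \<in> variable_ideal A <+>\<^bsub>S\<^esub> variable_ideal B"
      using restrict_support_add_compl[OF fS, of ?U] by (auto simp: set_add_def')
  qed
qed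

end

context power_series_field
begin

text \<open>
  If neither \<open>f\<close> nor \<open>g\<close> lies in the ideal, both have a term that avoids the variables in \<open>A\<close>. Take the ones
  of least rank, at \<open>a\<close> and \<open>b\<close>: no other pair of terms contributes to the coefficient of the product at
  \<open>a + b\<close>.
\<close>

lemma primeideal_variable_ideal: "primeideal (variable_ideal A) S"
proof (rule primeidealI)
  show "ideal (variable_ideal A) S"
    by (rule ideal_variable_ideal)
  show "cring S"
    by (rule PS.is_cring)
  have "\<one>\<^bsub>S\<^esub> \<notin> variable_ideal A"
  proof
    assume "\<one>\<^bsub>S\<^esub> \<in> variable_ideal A"
    then have "\<forall>m. set_mset m \<inter> A = {} \<longrightarrow> monomial K {#} m = \<zero>"
      unfolding variable_ideal_iff one_series by blast
    from spec[OF this, of "{#}"] show False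
      by (simp add: coeff_monomial)
  qed
  then show "carrier S \<noteq> variable_ideal A"
    using PS.one_closed by blast
  fix f g assume fg: "f \<in> carrier S" "g \<in> carrier S" "f \<otimes>\<^bsub>S\<^esub> g \<in> variable_ideal A"
  have least: "\<exists>a. set_mset a \<inter> A = {} \<and> u a \<noteq> \<zero> \<and>
      (\<forall>m. set_mset m \<inter> A = {} \<longrightarrow> u m \<noteq> \<zero> \<longrightarrow> rank a \<le> rank m)"
    if u: "u \<in> carrier S" "u \<notin> variable_ideal A" for u
  proof -
    obtain m where "set_mset m \<inter> A = {} \<and> u m \<noteq> \<zero>"
      using u by (auto simp: variable_ideal_iff)
    then show ?thesis
      using ex_has_least_nat[of "\<lambda>m. set_mset m \<inter> A = {} \<and> u m \<noteq> \<zero>" m rank]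
      by (simp add: imp_conjL)
  qed
  show "f \<in> variable_ideal A \<or> g \<in> variable_ideal A"
  proof (rule ccontr)
    assume "\<not> (f \<in> variable_ideal A \<or> g \<in> variable_ideal A)"
    then have outside: "f \<notin> variable_ideal A" "g \<notin> variable_ideal A"
      by blast+
    obtain a where a: "set_mset a \<inter> A = {}" "f a \<noteq> \<zero>"
        "\<And>m. set_mset m \<inter> A = {} \<Longrightarrow> f m \<noteq> \<zero> \<Longrightarrow> rank a \<le> rank m"
      using least[OF fg(1) outside(1)] by blast
    obtain b where b: "set_mset b \<inter> A = {}" "g b \<noteq> \<zero>"
        "\<And>m. set_mset m \<inter> A = {} \<Longrightarrow> g m \<noteq> \<zero> \<Longrightarrow> rank b \<le> rank m"
      using least[OF fg(2) outside(2)] by blast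
    have "f c \<otimes> g (a + b - c) = \<zero>" if c: "c \<subseteq># a + b" "c \<noteq> a" for c
    proof (rule ccontr)
      assume nz: "f c \<otimes> g (a + b - c) \<noteq> \<zero>"
      define e where "e = a + b - c"
      have ce: "a + b = c + e"
        using c(1) by (simp add: e_def)
      have nz': "f c \<noteq> \<zero>" "g e \<noteq> \<zero>"
        using nz fg by (auto simp: e_def)
      have "set_mset c \<union> set_mset e = set_mset a \<union> set_mset b"
        using arg_cong[OF ce, of set_mset] by simp
      then have "set_mset c \<inter> A = {}" "set_mset e \<inter> A = {}"
        using a(1) b(1) by blast+
      then have le: "rank a \<le> rank c" "rank b \<le> rank e"
        using a(3) b(3) nz' by blast+
      have "rank a * rank b = rank c * rank e"
        using ce by (metis rank_add)
      with le have "rank a = rank c"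
        using mult_less_le_imp_less[of "rank a" "rank c" "rank b" "rank e"] rank_pos[of b]
        by (cases "rank a < rank c") auto
      moreover have "set_mset a \<subseteq> V" "set_mset c \<subseteq> V"
        using coeff_outside[OF fg(1)] a(2) nz'(1) by blast+
      ultimately show False
        using rank_inj c(2) by blast
    qed
    then have "(f \<otimes>\<^bsub>S\<^esub> g) (a + b)
        = (\<Oplus>c\<in>{c. c \<subseteq># a + b}. if c = a then f c \<otimes> g (a + b - c) else \<zero>)"
      unfolding coeff_mult using fg by (intro finsum_cong') auto
    also have "\<dots> = f a \<otimes> g b"
      using add.finprod_singleton_swap[of a "{c. c \<subseteq># a + b}" "\<lambda>c. f c \<otimes> g (a + b - c)"] fg
      by (simp add: finite_submultisets Pi_def)
    also have "\<dots> \<noteq> \<zero>"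
      using a(2) b(2) fg by (simp add: integral_iff)
    finally show False
      using fg(3) a(1) b(1) by (simp add: variable_ideal_iff Int_Un_distrib2)
  qed
qed

lemma variable_ideal_strict_mono:
  assumes "A \<subseteq> B" "i \<in> B" "i \<notin> A" "i \<in> V"
  shows "variable_ideal A \<subset> variable_ideal B"
proof -
  have "monomial K {#i#} \<in> variable_ideal B"
    unfolding variable_ideal_def using assms by (intro monomial_in_monomial_ideal) auto
  moreover have "monomial K {#i#} \<notin> variable_ideal A"
    using assms by (auto simp: variable_ideal_iff coeff_monomial intro!: exI[of _ "{#i#}"])
  ultimately show ?thesis
    using variable_ideal_mono[OF assms(1)] by blast
qed

text \<open>
  An elementary case of Krull's principal ideal theorem. Since \<open>X\<^sub>i\<close> is not in \<open>Q\<close>, a member of \<open>Q\<close> that is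
  divisible by \<open>X\<^sub>i\<close> stays in \<open>Q\<close> after division. Modulo \<open>variable_ideal A\<close>
  all members of \<open>Q\<close> are divisible by \<open>X\<^sub>i\<close>, hence by every power of it, and must vanish.
\<close>

lemma no_prime_between:
  assumes Q: "primeideal Q S" and AQ: "variable_ideal A \<subseteq> Q"
    and QA: "Q \<subset> variable_ideal (insert i A)" and i: "i \<in> V" and A: "A \<subseteq> V"
  shows "Q = variable_ideal A"
proof
  interpret Q: primeideal Q S by fact
  show "variable_ideal A \<subseteq> Q" by fact
  have X: "monomial K {#i#} \<notin> Q"
  proof
    assume Xi: "monomial K {#i#} \<in> Q"
    have "finite A"
      using A finite_V by (rule finite_subset)
    then have "variable_ideal (insert i A) \<subseteq> Q"
      using AQ Xi A i variable_ideal_subset_iff_variables[OF Q.is_ideal] by simp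
    with QA show False by blast
  qed
  (* Division by the variable lowers the size of the monomial m, which cannot go on forever. *)
  have no: False if "f \<in> Q" "\<And>m. set_mset m \<inter> A \<noteq> {} \<Longrightarrow> f m = \<zero>" "f m \<noteq> \<zero>" for f m
    using that
  proof (induction "size m" arbitrary: f m rule: less_induct)
    case less
    have fS: "f \<in> carrier S"
      using less.prems(1) by (rule Q.Icarr)
    have supp: "i \<in># a" if "f a \<noteq> \<zero>" for a
    proof -
      have "f \<in> variable_ideal (insert i A)"
        using less.prems(1) QA by blast
      with that less.prems(2)[of a] show ?thesis
        by (auto simp: variable_ideal_iff)
    qed
    define g where "g a = f (add_mset i a)" for a
    have g: "g \<in> carrier S"
      using fS i by (auto simp: series_carrier_iff g_def)
    have "f = monomial K {#i#} \<otimes>\<^bsub>S\<^esub> g"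
      using supp by (auto simp: fun_eq_iff coeff_monomial_mult[OF g] g_def)
    with less.prems(1) X have "g \<in> Q"
      using Q.I_prime[of "monomial K {#i#}" g] g i by auto
    obtain a where a: "m = add_mset i a"
      using supp[OF less.prems(3)] by (metis mset_add)
    show False
    proof (rule less.hyps[OF _ \<open>g \<in> Q\<close>])
      show "size a < size m"
        by (simp add: a)
      show "g b = \<zero>" if "set_mset b \<inter> A \<noteq> {}" for b
        unfolding g_def using that by (intro less.prems(2)) auto
      show "g a \<noteq> \<zero>"
        using less.prems(3) by (simp add: g_def a)
    qed
  qed
  show "Q \<subseteq> variable_ideal A"
  proof
    fix f assume f: "f \<in> Q"
    then have fS: "f \<in> carrier S"
      by (rule Q.Icarr)
    let ?U = "{m. set_mset m \<inter> A \<noteq> {}}"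
    have "restrict_support ?U f \<in> Q"
      using restrict_support_in_monomial_ideal[OF fS, of ?U] AQ by (auto simp: variable_ideal_def)
    with f have "f \<ominus>\<^bsub>S\<^esub> restrict_support ?U f \<in> Q"
      by (simp add: a_minus_def Q.a_closed Q.a_inv_closed)
    then have "restrict_support (- ?U) f \<in> Q"
      by (simp add: minus_restrict_support[OF fS])
    then have "restrict_support (- ?U) f m = \<zero>" for m
    proof -
      assume Q: "restrict_support (- ?U) f \<in> Q"
      show ?thesis
      proof (rule ccontr)
        assume "restrict_support (- ?U) f m \<noteq> \<zero>"
        then show False
          by (rule no[OF Q, rotated]) (simp add: restrict_support_def)
      qed
    qed
    then have "f m = \<zero>" if "set_mset m \<inter> A = {}" for m
      using that by (metis (mono_tags, lifting) ComplI mem_Collect_eq restrict_support_def)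
    with fS show "f \<in> variable_ideal A"
      by (simp add: variable_ideal_iff)
  qed
qed

end

section \<open>Prime ideals under surjective homomorphisms\<close>

lemma prime_chain_mono:
  assumes "prime_chain R k P" "i \<le> j" "j \<le> k"
  shows "P i \<subseteq> P j"
  using assms(2,3)
proof (induction j rule: dec_induct)
  case (step j)
  then have "P j \<subset> P (Suc j)"
    using assms(1) by (simp add: prime_chain_def)
  with step show ?case by auto
qed simp

lemma prime_height_mono:
  assumes p: "primeideal p R" and q: "primeideal q R" and pq: "p \<subseteq> q"
  shows "prime_height R p \<le> prime_height R q"
proof (cases "p = q")
  case False
  have "\<exists>P. prime_chain R (Suc k) P \<and> P (Suc k) = q" if "prime_chain R k P" "P k = p" for k P
    using that q pq False
    by (intro exI[of _ "P(Suc k := q)"]) (auto simp: prime_chain_def less_Suc_eq le_Suc_eq)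
  then have "\<exists>j\<in>{k. \<exists>P. prime_chain R k P \<and> P k = q}. enat k \<le> enat j"
    if "k \<in> {k. \<exists>P. prime_chain R k P \<and> P k = p}" for k
    using that by (intro bexI[of _ "Suc k"]) auto
  then show ?thesis
    unfolding prime_height_def by (intro SUP_mono) blast
qed simp

lemma ideal_height_prime:
  assumes p: "primeideal p R"
  shows "ideal_height R p = prime_height R p"
  unfolding ideal_height_def
proof (rule antisym)
  show "(INF q\<in>{q. primeideal q R \<and> p \<subseteq> q}. prime_height R q) \<le> prime_height R p"
    using p by (intro INF_lower2[of p]) auto
  show "prime_height R p \<le> (INF q\<in>{q. primeideal q R \<and> p \<subseteq> q}. prime_height R q)"
    using p by (intro INF_greatest) (auto intro: prime_height_mono)
qed

text \<open>
  Quotient maps, their compositions and the automorphisms of a power series ring are treated alike: for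
  a surjective homomorphism, image and preimage identify the prime ideals of the target with those
  prime ideals of the source that contain the kernel.
\<close>

locale surjective_hom = ring_hom_cring R S h for R (structure) and S (structure) and h +
  assumes surj: "h ` carrier R = carrier S"
begin

abbreviation ker :: "'a set"
  where "ker \<equiv> a_kernel R S h"

definition pull :: "'c set \<Rightarrow> 'a set"
  where "pull J = {r \<in> carrier R. h r \<in> J}"

lemma ideal_pull: "ideal J S \<Longrightarrow> ideal (pull J) R"
  unfolding pull_def by (rule ring.ideal_vimage)

lemma ker_le_pull: "ideal J S \<Longrightarrow> ker \<subseteq> pull J"
  unfolding pull_def a_kernel_def' using additive_subgroup.zero_closed[OF ideal.axioms(1)]
  by fastforce

lemma image_pull: "J \<subseteq> carrier S \<Longrightarrow> h ` pull J = J"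
  using surj by (auto simp: pull_def)

lemma pull_image:
  assumes I: "ideal I R" and "ker \<subseteq> I"
  shows "pull (h ` I) = I"
proof
  interpret I: ideal I R by fact
  show "I \<subseteq> pull (h ` I)"
    using I.Icarr by (auto simp: pull_def)
  show "pull (h ` I) \<subseteq> I"
  proof
    fix r assume "r \<in> pull (h ` I)"
    then obtain a where a: "r \<in> carrier R" "a \<in> I" "h r = h a"
      by (auto simp: pull_def)
    have "a \<in> carrier R"
      using a(2) by (rule I.Icarr)
    with a have "r \<ominus> a \<in> ker"
      unfolding a_kernel_def' by (simp add: a_minus_def S.r_neg)
    with assms(2) have "(r \<ominus> a) \<oplus> a \<in> I"
      using a(2) by blast
    moreover have "(r \<ominus> a) \<oplus> a = r"
      using a(1) I.Icarr[OF a(2)] by (simp add: a_minus_def R.a_assoc R.l_neg)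
    ultimately show "r \<in> I"
      by simp
  qed
qed

lemma ideal_image:
  assumes I: "ideal I R"
  shows "ideal (h ` I) S"
proof (rule idealI)
  interpret I: ideal I R by fact
  show "ring S"
    by (rule S.ring_axioms)
  show "subgroup (h ` I) (add_monoid S)"
    by (rule ring.img_is_add_subgroup[OF I.a_subgroup])
  fix a x assume "a \<in> h ` I" "x \<in> carrier S"
  then obtain i r where ir: "i \<in> I" "a = h i" "r \<in> carrier R" "x = h r"
    using surj by blast
  then have "x \<otimes>\<^bsub>S\<^esub> a = h (r \<otimes> i)" "a \<otimes>\<^bsub>S\<^esub> x = h (i \<otimes> r)"
    using I.Icarr by simp_all
  with ir show "x \<otimes>\<^bsub>S\<^esub> a \<in> h ` I" "a \<otimes>\<^bsub>S\<^esub> x \<in> h ` I"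
    using I.I_l_closed I.I_r_closed by blast+
qed

lemma primeideal_pull:
  assumes P: "primeideal P S"
  shows "primeideal (pull P) R"
proof (rule primeidealI)
  interpret P: primeideal P S by fact
  show "ideal (pull P) R"
    by (rule ideal_pull[OF P.is_ideal])
  show "cring R"
    by (rule R.is_cring)
  show "carrier R \<noteq> pull P"
  proof
    assume "carrier R = pull P"
    then have "\<one> \<in> pull P"
      using R.one_closed by simp
    then have "\<one>\<^bsub>S\<^esub> \<in> P"
      by (simp add: pull_def)
    then show False
      using P.one_imp_carrier P.I_notcarr by blast
  qed
  show "a \<in> pull P \<or> b \<in> pull P" if "a \<in> carrier R" "b \<in> carrier R" "a \<otimes> b \<in> pull P" for a b
    using that P.I_prime[of "h a" "h b"] by (auto simp: pull_def)
qed

lemma primeideal_image: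
  assumes P: "primeideal P R" and "ker \<subseteq> P"
  shows "primeideal (h ` P) S"
proof (rule primeidealI)
  interpret P: primeideal P R by fact
  have mem: "h r \<in> h ` P \<longleftrightarrow> r \<in> P" if "r \<in> carrier R" for r
    using pull_image[OF P.is_ideal assms(2)] that by (auto simp: pull_def)
  show "ideal (h ` P) S"
    by (rule ideal_image[OF P.is_ideal])
  show "cring S"
    by (rule S.is_cring)
  show "carrier S \<noteq> h ` P"
    using P.I_notcarr P.Icarr mem hom_closed by blast
  fix a b assume ab: "a \<in> carrier S" "b \<in> carrier S" "a \<otimes>\<^bsub>S\<^esub> b \<in> h ` P"
  then obtain r s where rs: "r \<in> carrier R" "a = h r" "s \<in> carrier R" "b = h s"
    using surj by blast
  with ab have "h (r \<otimes> s) \<in> h ` P"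
    by simp
  then have "r \<in> P \<or> s \<in> P"
    using rs mem[of "r \<otimes> s"] P.I_prime by simp
  with rs show "a \<in> h ` P \<or> b \<in> h ` P"
    by blast
qed

lemma pull_strict_mono:
  assumes "P \<subset> Q" "Q \<subseteq> carrier S"
  shows "pull P \<subset> pull Q"
proof -
  have "pull P \<subseteq> pull Q"
    using assms by (auto simp: pull_def)
  moreover have "pull P \<noteq> pull Q"
  proof
    assume "pull P = pull Q"
    then have "h ` pull P = h ` pull Q"
      by (rule arg_cong)
    moreover have "P \<subseteq> carrier S"
      using assms by blast
    ultimately show False
      using assms by (simp add: image_pull)
  qed
  ultimately show ?thesis
    by blast
qed

lemma image_strict_mono:
  assumes "ideal P R" "ideal Q R" "ker \<subseteq> P" "P \<subset> Q"
  shows "h ` P \<subset> h ` Q"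
proof -
  have "h ` P \<noteq> h ` Q"
  proof
    assume "h ` P = h ` Q"
    then have "pull (h ` P) = pull (h ` Q)"
      by (rule arg_cong)
    moreover have "ker \<subseteq> Q"
      using assms by blast
    ultimately show False
      using assms by (simp add: pull_image)
  qed
  with assms(4) show ?thesis
    by blast
qed

lemma prime_chain_pull:
  assumes "prime_chain S k P"
  shows "prime_chain R k (\<lambda>i. pull (P i))" "ker \<subseteq> pull (P 0)"
proof -
  have P: "primeideal (P i) S" if "i \<le> k" for i
    using assms that by (simp add: prime_chain_def)
  have sub: "P i \<subseteq> carrier S" if "i \<le> k" for i
    using P[OF that] by (simp add: additive_subgroup.a_subset ideal.axioms(1) primeideal.axioms(1))
  show "prime_chain R k (\<lambda>i. pull (P i))"
    unfolding prime_chain_def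
  proof (intro conjI allI impI)
    show "primeideal (pull (P i)) R" if "i \<le> k" for i
      by (rule primeideal_pull[OF P[OF that]])
    show "pull (P i) \<subset> pull (P (Suc i))" if "i < k" for i
      using assms that by (intro pull_strict_mono sub) (simp_all add: prime_chain_def)
  qed
  show "ker \<subseteq> pull (P 0)"
    using P[of 0] by (simp add: ker_le_pull primeideal.axioms(1))
qed

lemma prime_chain_image:
  assumes "prime_chain R k Q" "ker \<subseteq> Q 0"
  shows "prime_chain S k (\<lambda>i. h ` Q i)"
proof -
  have ker: "ker \<subseteq> Q i" if "i \<le> k" for i
    using assms prime_chain_mono[OF assms(1), of 0 i] that by auto
  have Q: "primeideal (Q i) R" if "i \<le> k" for i
    using assms that by (simp add: prime_chain_def)
  show ?thesis
    unfolding prime_chain_def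
  proof (intro conjI allI impI)
    show "primeideal (h ` Q i) S" if "i \<le> k" for i
      by (rule primeideal_image[OF Q[OF that] ker[OF that]])
    show "h ` Q i \<subset> h ` Q (Suc i)" if "i < k" for i
      using assms(1) that Q[of i] Q[of "Suc i"]
      by (intro image_strict_mono primeideal.axioms(1) ker) (simp_all add: prime_chain_def)
  qed
qed

lemma krull_dim_eq:
  "krull_dim S = (SUP k\<in>{k. \<exists>Q. prime_chain R k Q \<and> ker \<subseteq> Q 0}. enat k)"
proof -
  have "(\<exists>P. prime_chain S k P) \<longleftrightarrow> (\<exists>Q. prime_chain R k Q \<and> ker \<subseteq> Q 0)" for k
    using prime_chain_pull prime_chain_image by blast
  then show ?thesis
    by (simp add: krull_dim_def)
qed

lemma prime_height_image:
  assumes p: "primeideal p R" "ker \<subseteq> p"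
  shows "prime_height S (h ` p)
    = (SUP k\<in>{k. \<exists>Q. prime_chain R k Q \<and> ker \<subseteq> Q 0 \<and> Q k = p}. enat k)"
proof -
  have "(\<exists>P. prime_chain S k P \<and> P k = h ` p) \<longleftrightarrow> (\<exists>Q. prime_chain R k Q \<and> ker \<subseteq> Q 0 \<and> Q k = p)"
    for k
  proof
    assume "\<exists>P. prime_chain S k P \<and> P k = h ` p"
    then obtain P where P: "prime_chain S k P" "P k = h ` p"
      by blast
    with prime_chain_pull[OF P(1)] pull_image[OF primeideal.axioms(1)[OF p(1)] p(2)]
    show "\<exists>Q. prime_chain R k Q \<and> ker \<subseteq> Q 0 \<and> Q k = p"
      by (intro exI[of _ "\<lambda>i. pull (P i)"]) simp
  next
    assume "\<exists>Q. prime_chain R k Q \<and> ker \<subseteq> Q 0 \<and> Q k = p"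
    then show "\<exists>P. prime_chain S k P \<and> P k = h ` p"
      using prime_chain_image by blast
  qed
  then show ?thesis
    by (simp add: prime_height_def)
qed

text \<open>
  The members of \<open>M\<close> are the primes minimal over the kernel. Minimality is recovered from a covering
  family, since that is how these primes are found in a monomial ideal.
\<close>

lemma minimal_primes_eq:
  assumes M: "\<And>p. p \<in> M \<Longrightarrow> primeideal p R \<and> ker \<subseteq> p"
    and cover: "\<And>q. primeideal q R \<Longrightarrow> ker \<subseteq> q \<Longrightarrow> \<exists>p\<in>M. p \<subseteq> q"
    and antichain: "\<And>p q. p \<in> M \<Longrightarrow> q \<in> M \<Longrightarrow> p \<subseteq> q \<Longrightarrow> p = q"
  shows "minimal_primes S = (`) h ` M"
proof (intro equalityI subsetI)
  fix P assume P: "P \<in> minimal_primes S"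
  then have prime: "primeideal P S"
    by (simp add: minimal_primes_def)
  then have Pid: "ideal P S"
    by (rule primeideal.axioms(1))
  obtain p where p: "p \<in> M" "p \<subseteq> pull P"
    using cover[OF primeideal_pull[OF prime] ker_le_pull[OF Pid]] by blast
  have "h ` p \<subseteq> P"
    using p(2) by (auto simp: pull_def)
  moreover have "primeideal (h ` p) S"
    using M[OF p(1)] by (simp add: primeideal_image)
  ultimately have "h ` p = P"
    using P by (auto simp: minimal_primes_def)
  with p show "P \<in> (`) h ` M"
    by blast
next
  fix P assume "P \<in> (`) h ` M"
  then obtain p where p: "p \<in> M" "P = h ` p"
    by blast
  have "q = P" if q: "primeideal q S" "q \<subseteq> P" for q
  proof -
    have qid: "ideal q S"
      using q(1) by (rule primeideal.axioms(1))
    have pp: "pull P = p"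
      using M[OF p(1)] p(2) pull_image primeideal.axioms(1) by blast
    obtain p' where p': "p' \<in> M" "p' \<subseteq> pull q"
      using cover[OF primeideal_pull[OF q(1)] ker_le_pull[OF qid]] by blast
    have "pull q \<subseteq> pull P"
      using q(2) by (auto simp: pull_def)
    with p' pp antichain[OF p'(1) p(1)] have "pull q = pull P"
      by auto
    then have "h ` pull q = h ` pull P"
      by simp
    moreover have "P \<subseteq> carrier S"
      using p M hom_closed ideal.Icarr primeideal.axioms(1) by (metis image_subsetI)
    ultimately show "q = P"
      using q(2) by (simp add: image_pull)
  qed
  with p M show "P \<in> minimal_primes S"
    by (auto simp: minimal_primes_def primeideal_image)
qed

lemma noetherian_image:
  assumes "noetherian_ring R"
  shows "noetherian_ring S"
proof (rule S.noetherian_ringI)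
  interpret N: noetherian_ring R by fact
  fix J assume J: "ideal J S"
  obtain A where A: "A \<subseteq> carrier R" "finite A" "pull J = Idl A"
    using N.finetely_gen[OF ideal_pull[OF J]] by blast
  have hA: "h ` A \<subseteq> carrier S"
    using A(1) by auto
  have Jsub: "J \<subseteq> carrier S"
    using ideal.Icarr[OF J] by blast
  have "J = Idl\<^bsub>S\<^esub> (h ` A)"
  proof
    have "A \<subseteq> pull J"
      using A R.genideal_self by simp
    then show "Idl\<^bsub>S\<^esub> (h ` A) \<subseteq> J"
      by (intro S.genideal_minimal J) (auto simp: pull_def)
    have "A \<subseteq> pull (Idl\<^bsub>S\<^esub> (h ` A))"
      using A(1) S.genideal_self[OF hA] by (auto simp: pull_def)
    then have "Idl A \<subseteq> pull (Idl\<^bsub>S\<^esub> (h ` A))"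
      by (intro R.genideal_minimal ideal_pull S.genideal_ideal hA)
    then have "h ` pull J \<subseteq> Idl\<^bsub>S\<^esub> (h ` A)"
      using A(3) by (auto simp: pull_def)
    then show "J \<subseteq> Idl\<^bsub>S\<^esub> (h ` A)"
      by (simp add: image_pull[OF Jsub])
  qed
  with A(2) hA show "\<exists>A\<subseteq>carrier S. finite A \<and> J = Idl\<^bsub>S\<^esub> A"
    by blast
qed

lemma image_set_add:
  assumes "I \<subseteq> carrier R" "J \<subseteq> carrier R"
  shows "h ` (I <+> J) = h ` I <+>\<^bsub>S\<^esub> h ` J"
proof -
  have "h (a \<oplus> b) = h a \<oplus>\<^bsub>S\<^esub> h b" if "a \<in> I" "b \<in> J" for a b
    using that assms by (intro hom_add) auto
  then show ?thesis
    unfolding set_add_def' by (simp add: image_UN)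
qed

text \<open>
  Preimages of proper ideals are proper, so that proper ideals of \<open>S\<close> lie in the image of \<open>m\<close>.
\<close>

lemma image_maximal_if_proper_below:
  assumes m: "ideal m R" "ker \<subseteq> m" "m \<noteq> carrier R"
    and below: "\<And>J. ideal J R \<Longrightarrow> J \<noteq> carrier R \<Longrightarrow> J \<subseteq> m"
  shows "maximalideal M S \<longleftrightarrow> M = h ` m"
proof -
  have proper: "h ` m \<noteq> carrier S"
  proof
    assume "h ` m = carrier S"
    then have "pull (h ` m) = carrier R"
      by (auto simp: pull_def)
    with pull_image[OF m(1,2)] m(3) show False
      by simp
  qed
  have le: "J \<subseteq> h ` m" if J: "ideal J S" "J \<noteq> carrier S" for J
  proof -
    have Jc: "J \<subseteq> carrier S"
      using ideal.Icarr[OF J(1)] by blast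
    have "pull J \<noteq> carrier R"
      using image_pull[OF Jc] surj J(2) by auto
    then have "pull J \<subseteq> m"
      by (rule below[OF ideal_pull[OF J(1)]])
    then show ?thesis
      using image_pull[OF Jc] by blast
  qed
  show ?thesis
  proof
    assume "maximalideal M S"
    then interpret M: maximalideal M S .
    have "M \<subseteq> h ` m"
      using M.I_notcarr by (intro le M.is_ideal) auto
    then show "M = h ` m"
      using M.I_maximal[OF ideal_image[OF m(1)]] proper ideal.Icarr[OF ideal_image[OF m(1)]] by blast
  next
    assume M: "M = h ` m"
    show "maximalideal M S"
      unfolding M
    proof (rule maximalidealI)
      show "J = h ` m \<or> J = carrier S" if "ideal J S" "h ` m \<subseteq> J" for J
        using le[OF that(1)] that(2) by blast
    qed (use proper ideal_image[OF m(1)] in auto)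
  qed
qed

end

lemma surjective_hom_comp:
  assumes "surjective_hom R S h" "surjective_hom S T g"
  shows "surjective_hom R T (g \<circ> h)"
    and "a_kernel R T (g \<circ> h) = {r \<in> carrier R. h r \<in> a_kernel S T g}"
proof -
  interpret h: surjective_hom R S h by fact
  interpret g: surjective_hom S T g by fact
  have "g \<circ> h \<in> ring_hom R T"
    using h.homh g.homh by (rule ring_hom_trans)
  then have "ring_hom_cring R T (g \<circ> h)"
    by (intro ring_hom_cringI ring_hom_ringI2) (simp_all add: h.R.ring_axioms g.S.ring_axioms h.R.is_cring g.S.is_cring)
  then show "surjective_hom R T (g \<circ> h)"
    by (intro surjective_hom.intro surjective_hom_axioms.intro)
      (simp_all only: image_comp[symmetric] h.surj g.surj)
  show "a_kernel R T (g \<circ> h) = {r \<in> carrier R. h r \<in> a_kernel S T g}"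
    unfolding a_kernel_def' by auto
qed

lemma surjective_hom_quotient:
  fixes R (structure)
  assumes "cring R" "ideal I R"
  shows "surjective_hom R (R Quot I) ((+>) I)" and "a_kernel R (R Quot I) ((+>) I) = I"
proof -
  interpret ideal I R by fact
  interpret cring R by fact
  interpret q: ring_hom_cring R "R Quot I" "(+>) I"
    by (rule rcos_ring_hom_cring[OF \<open>cring R\<close>])
  show "surjective_hom R (R Quot I) ((+>) I)"
  proof
    show "(+>) I ` carrier R = carrier (R Quot I)"
      unfolding FactRing_def A_RCOSETS_def' by auto
  qed
  have coset: "I +> x = \<zero>\<^bsub>R Quot I\<^esub> \<longleftrightarrow> x \<in> I" if "x \<in> carrier R" for x
    unfolding FactRing_def ring.simps using that rcos_const_imp_mem a_rcos_const by blast
  show "a_kernel R (R Quot I) ((+>) I) = I"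
    unfolding a_kernel_def'
  proof (intro equalityI subsetI)
    fix x assume "x \<in> {x \<in> carrier R. I +> x = \<zero>\<^bsub>R Quot I\<^esub>}"
    then show "x \<in> I"
      using coset by blast
  next
    fix x assume "x \<in> I"
    then show "x \<in> {x \<in> carrier R. I +> x = \<zero>\<^bsub>R Quot I\<^esub>}"
      using coset Icarr by blast
  qed
qed

section \<open>Completeness of quotients by monomial ideals\<close>

context power_series
begin

text \<open>
  The series of order at least \<open>k\<close>. Over a field, this is the \<open>k\<close>-th power of the
  maximal ideal.
\<close>

definition order_ideal :: "nat \<Rightarrow> ('i multiset \<Rightarrow> 'k) set"
  where "order_ideal k = monomial_ideal {m. k \<le> size m}"

lemma order_ideal_iff:
  "f \<in> order_ideal k \<longleftrightarrow> f \<in> carrier S \<and> (\<forall>m. size m < k \<longrightarrow> f m = \<zero>)"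
  by (auto simp: order_ideal_def monomial_ideal_def not_le)

lemma upward_closed_size: "upward_closed {m. k \<le> size m}"
  by (rule upward_closedI) (use size_mset_mono le_trans in blast)

lemma ideal_order_ideal: "ideal (order_ideal k) S"
  unfolding order_ideal_def by (rule ideal_monomial_ideal[OF upward_closed_size])

lemma order_ideal_0: "order_ideal 0 = carrier S"
  by (auto simp: order_ideal_iff)

end

context power_series_field
begin

lemma proper_ideal_le_order_ideal:
  assumes "ideal J S" "J \<noteq> carrier S"
  shows "J \<subseteq> order_ideal 1"
proof
  fix f assume f: "f \<in> J"
  with assms have "f {#} = \<zero>"
    using ideal_nonzero_const_eq_carrier by blast
  with f assms(1) show "f \<in> order_ideal 1"
    by (simp add: order_ideal_iff ideal.Icarr)
qed

lemma order_ideal_1_proper: "order_ideal 1 \<noteq> carrier S"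
proof
  assume "order_ideal 1 = carrier S"
  then have "\<one>\<^bsub>S\<^esub> \<in> order_ideal 1"
    using PS.one_closed by simp
  then have "\<forall>m :: 'i multiset. size m < 1 \<longrightarrow> monomial K {#} m = \<zero>"
    unfolding order_ideal_iff one_series by blast
  from spec[OF this, of "{#}"] show False
    by (simp add: coeff_monomial)
qed

text \<open>
  That products of \<open>k + 1\<close> series without constant term have order at least \<open>k + 1\<close> is clear. Conversely,
  series of order at least \<open>k + 1\<close> form a monomial ideal, generated by finitely many monomials of degree
  at least \<open>k + 1\<close>; splitting off one variable leaves a monomial of degree at least \<open>k\<close>.
\<close>

lemma image_order_ideal_eq_pow:
  assumes "surjective_hom S R h"
  shows "(h ` order_ideal 1) [^]\<^bsub>ideals_set R\<^esub> k = h ` order_ideal k"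
proof (induction k)
  interpret surjective_hom S R h by fact
  interpret id: comm_monoid "ideals_set R"
    by (rule S.ideals_set_is_comm_monoid)
  case 0
  show ?case
    by (simp add: order_ideal_0 surj) (simp add: ideals_set_def)
next
  interpret surjective_hom S R h by fact
  interpret id: comm_monoid "ideals_set R"
    by (rule S.ideals_set_is_comm_monoid)
  case (Suc k)
  have "(h ` order_ideal 1) [^]\<^bsub>ideals_set R\<^esub> Suc k = ideal_prod R (h ` order_ideal k) (h ` order_ideal 1)"
    unfolding id.nat_pow_Suc Suc.IH by (simp add: ideals_set_def)
  also have "\<dots> = h ` order_ideal (Suc k)"
  proof
    have idk: "ideal (h ` order_ideal j) R" for j
      by (rule ideal_image[OF ideal_order_ideal])
    show "ideal_prod R (h ` order_ideal k) (h ` order_ideal 1) \<subseteq> h ` order_ideal (Suc k)"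
    proof
      fix x assume "x \<in> ideal_prod R (h ` order_ideal k) (h ` order_ideal 1)"
      then show "x \<in> h ` order_ideal (Suc k)"
      proof induction
        case (prod x y)
        then obtain f g where fg: "f \<in> order_ideal k" "x = h f" "g \<in> order_ideal 1" "y = h g"
          by blast
        then have carr: "f \<in> carrier S" "g \<in> carrier S"
          by (simp_all add: order_ideal_iff)
        have "(f \<otimes>\<^bsub>S\<^esub> g) m = \<zero>" if m: "size m < Suc k" for m
        proof (rule coeff_mult_eq_zero[OF carr])
          fix a b assume "m = a + b"
          with m have "size a + size b < Suc k"
            by simp
          then have "size a < k \<or> size b < 1"
            by linarith
          with fg show "f a = \<zero> \<or> g b = \<zero>"
            unfolding order_ideal_iff by blast
        qed
        then have "f \<otimes>\<^bsub>S\<^esub> g \<in> order_ideal (Suc k)"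
          using carr by (simp add: order_ideal_iff)
        moreover have "x \<otimes>\<^bsub>R\<^esub> y = h (f \<otimes>\<^bsub>S\<^esub> g)"
          using fg carr by simp
        ultimately show ?case
          by blast
      next
        case (sum x y)
        show ?case
          using sum.IH by (rule additive_subgroup.a_closed[OF ideal.axioms(1)[OF idk]])
      qed
    qed
    let ?J = "ideal_prod R (h ` order_ideal k) (h ` order_ideal 1)"
    have J: "ideal ?J R"
      by (rule S.ideal_prod_is_ideal[OF idk idk])
    obtain B where B: "B \<subseteq> {m. Suc k \<le> size m} \<inter> monomials" "finite B"
      "\<And>m. m \<in> {m. Suc k \<le> size m} \<inter> monomials \<Longrightarrow> \<exists>b\<in>B. b \<subseteq># m"
      using dickson[OF finite_V, of "{m. Suc k \<le> size m} \<inter> monomials"] by blast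
    have mono: "monomial K b \<in> pull ?J" if b: "b \<in> B" for b
    proof -
      from b B(1) have size: "Suc k \<le> size b" and over: "set_mset b \<subseteq> V"
        by auto
      then obtain i a where b_eq: "b = add_mset i a"
        by (cases b) auto
      then have "monomial K a \<in> order_ideal k" "monomial K {#i#} \<in> order_ideal 1"
        unfolding order_ideal_def using size over by (auto intro!: monomial_in_monomial_ideal)
      then have "h (monomial K a) \<otimes>\<^bsub>R\<^esub> h (monomial K {#i#}) \<in> ?J"
        by (intro ideal_prod.prod) auto
      moreover have "monomial K b = monomial K a \<otimes>\<^bsub>S\<^esub> monomial K {#i#}"
        using monomial_add[of a "{#i#}"] over b_eq by simp
      ultimately show ?thesis
        using over b_eq by (simp add: pull_def)
    qed
    have "order_ideal (Suc k) \<subseteq> pull ?J"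
    proof
      fix f assume f: "f \<in> order_ideal (Suc k)"
      show "f \<in> pull ?J"
      proof (rule in_ideal_if_support_generated[OF ideal_pull[OF J] B(2)])
        show fS: "f \<in> carrier S"
          using f by (simp add: order_ideal_iff)
        fix m assume "f m \<noteq> \<zero>"
        then have "m \<in> {m. Suc k \<le> size m} \<inter> monomials"
          using f coeff_outside[OF fS, of m] by (auto simp: order_ideal_iff not_less[symmetric])
        from B(3)[OF this] mono show "\<exists>b\<in>B. b \<subseteq># m \<and> monomial K b \<in> pull ?J"
          by blast
      qed
    qed
    then show "h ` order_ideal (Suc k) \<subseteq> ?J"
      by (auto simp: pull_def)
  qed
  finally show ?case .
qed

text \<open>
  Modulo the kernel the coefficients at monomials in \<open>U\<close> can be changed at will, whereas the others are
  determined. So the adic topology on \<open>R\<close> is that of coefficientwise convergence outside \<open>U\<close>, and the limit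
  of a Cauchy sequence is read off from the coefficients, which become constant.
\<close>

theorem complete_local_ring_monomial_quotient:
  assumes h: "surjective_hom S R h" and ker_h: "a_kernel S R h = monomial_ideal U"
    and U: "{#} \<notin> U"
  shows "complete_local_ring R"
proof -
  interpret surjective_hom S R h by fact
  have ker_le: "ker \<subseteq> order_ideal 1"
    unfolding ker_h using U by (auto simp: monomial_ideal_def order_ideal_iff)
  have max_iff: "maximalideal M R \<longleftrightarrow> M = h ` order_ideal 1" for M
    by (rule image_maximal_if_proper_below[OF ideal_order_ideal ker_le order_ideal_1_proper])
      (rule proper_ideal_le_order_ideal)
  have mem_iff: "h f \<in> h ` order_ideal k \<longleftrightarrow> (\<forall>m. m \<notin> U \<longrightarrow> size m < k \<longrightarrow> f m = \<zero>)"
    if f: "f \<in> carrier S" for f k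
  proof
    assume "h f \<in> h ` order_ideal k"
    then obtain g where g: "g \<in> order_ideal k" "h f = h g"
      by blast
    then have gS: "g \<in> carrier S"
      by (simp add: order_ideal_iff)
    have "f \<ominus>\<^bsub>S\<^esub> g \<in> ker"
      unfolding a_kernel_def' using f gS g(2) by (simp add: a_minus_def S.r_neg)
    then have "\<And>m. m \<notin> U \<Longrightarrow> (f \<ominus>\<^bsub>S\<^esub> g) m = \<zero>"
      unfolding ker_h by (simp add: monomial_ideal_def)
    then have "f m = g m" if "m \<notin> U" for m
      using that f gS by (simp add: r_right_minus_eq)
    with g(1) show "\<forall>m. m \<notin> U \<longrightarrow> size m < k \<longrightarrow> f m = \<zero>"
      by (simp add: order_ideal_iff)
  next
    assume "\<forall>m. m \<notin> U \<longrightarrow> size m < k \<longrightarrow> f m = \<zero>"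
    then have "restrict_support (- U) f \<in> order_ideal k"
      using restrict_support_closed[OF f, of "- U"] by (simp add: order_ideal_iff) (simp add: restrict_support_def)
    moreover have "restrict_support U f \<in> ker"
      unfolding ker_h by (rule restrict_support_in_monomial_ideal[OF f])
    then have "h (restrict_support U f) = \<zero>\<^bsub>R\<^esub>"
      unfolding a_kernel_def' by blast
    then have "h f = h (restrict_support (- U) f)"
      using restrict_support_add_compl[OF f, of U] f hom_add[of "restrict_support U f" "restrict_support (- U) f"] by simp
    ultimately show "h f \<in> h ` order_ideal k"
      by simp
  qed
  have diff: "h f \<ominus>\<^bsub>R\<^esub> h g = h (f \<ominus>\<^bsub>S\<^esub> g)" if "f \<in> carrier S" "g \<in> carrier S" for f g
    using that by (simp add: a_minus_def)
  have pow: "M [^]\<^bsub>ideals_set R\<^esub> k = h ` order_ideal k" if "maximalideal M R" for M and k :: nat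
    using that image_order_ideal_eq_pow[OF h] by (simp add: max_iff)
  show ?thesis
  proof (intro complete_local_ring.intro noetherian_local_ring.intro
      complete_local_ring_axioms.intro noetherian_local_ring_axioms.intro)
    show "cring R"
      by (rule S.is_cring)
    show "noetherian_ring R"
      by (rule noetherian_image[OF noetherian])
    show "\<exists>!M. maximalideal M R"
      by (simp add: max_iff)
  next
    fix M assume M: "maximalideal M R"
    have eq_zero: "r = \<zero>\<^bsub>R\<^esub>" if r: "\<And>k. r \<in> h ` order_ideal k" for r
    proof -
      obtain f where f: "f \<in> carrier S" "r = h f"
        using r[of 0] by (auto simp: order_ideal_0)
      have "f m = \<zero>" if "m \<notin> U" for m
        using mem_iff[OF f(1), of "Suc (size m)"] r f(2) that by blast
      with f have "f \<in> ker"
        unfolding ker_h by (simp add: monomial_ideal_def)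
      with f(2) show ?thesis
        unfolding a_kernel_def' by blast
    qed
    have zero_mem: "\<zero>\<^bsub>R\<^esub> \<in> h ` order_ideal k" for k
      by (rule additive_subgroup.zero_closed[OF ideal.axioms(1)[OF ideal_image[OF ideal_order_ideal]]])
    show "(\<Inter>k::nat. M [^]\<^bsub>ideals_set R\<^esub> k) = {\<zero>\<^bsub>R\<^esub>}"
      unfolding pow[OF M]
    proof (intro equalityI subsetI)
      fix r assume "r \<in> (\<Inter>k. h ` order_ideal k)"
      then have "r = \<zero>\<^bsub>R\<^esub>"
        by (intro eq_zero) (rule INT_D[OF _ UNIV_I])
      then show "r \<in> {\<zero>\<^bsub>R\<^esub>}"
        by (rule ssubst) (rule singletonI)
    next
      fix r assume "r \<in> {\<zero>\<^bsub>R\<^esub>}"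
      then have "r = \<zero>\<^bsub>R\<^esub>"
        by (rule singletonD)
      then show "r \<in> (\<Inter>k. h ` order_ideal k)"
        using zero_mem by (intro INT_I) (simp only:)
    qed
  next
    fix M and x :: "nat \<Rightarrow> _"
    assume M: "maximalideal M R" and x: "\<And>i. x i \<in> carrier R"
      and cauchy: "\<And>k::nat. \<exists>N. \<forall>i\<ge>N. \<forall>j\<ge>N. x i \<ominus>\<^bsub>R\<^esub> x j \<in> M [^]\<^bsub>ideals_set R\<^esub> k"
    obtain f where f: "\<And>i. f i \<in> carrier S" "\<And>i. x i = h (f i)"
    proof -
      have "\<forall>i. \<exists>g. g \<in> carrier S \<and> x i = h g"
        using x surj by blast
      with that show thesis
        by metis
    qed
    obtain N where N: "\<And>k i j. i \<ge> N k \<Longrightarrow> j \<ge> N k \<Longrightarrow> h (f i \<ominus>\<^bsub>S\<^esub> f j) \<in> h ` order_ideal k"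
    proof -
      have "\<forall>k. \<exists>N. \<forall>i\<ge>N. \<forall>j\<ge>N. h (f i \<ominus>\<^bsub>S\<^esub> f j) \<in> h ` order_ideal k"
        using cauchy unfolding pow[OF M] f(2) diff[OF f(1) f(1)] by (rule allI)
      from choice[OF this] that show thesis
        by metis
    qed
    have agree: "f i m = f j m"
      if "i \<ge> N (Suc (size m))" "j \<ge> N (Suc (size m))" "m \<notin> U" for i j m
    proof -
      have "\<forall>m'. m' \<notin> U \<longrightarrow> size m' < Suc (size m) \<longrightarrow> (f i \<ominus>\<^bsub>S\<^esub> f j) m' = \<zero>"
        using N[OF that(1,2)] mem_iff[OF PS.minus_closed[OF f(1) f(1)]] by blast
      then have "(f i \<ominus>\<^bsub>S\<^esub> f j) m = \<zero>"
        using that(3) by blast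
      then show ?thesis
        using f(1) by (simp add: r_right_minus_eq)
    qed
    (* Beyond N k the coefficients of degree less than k outside U no longer change. *)
    define y where "y m = (if m \<in> U then \<zero> else f (N (Suc (size m))) m)" for m
    have y: "y \<in> carrier S"
      using f(1) by (auto simp: y_def series_carrier_iff)
    have "\<exists>N. \<forall>i\<ge>N. x i \<ominus>\<^bsub>R\<^esub> h y \<in> M [^]\<^bsub>ideals_set R\<^esub> k" for k :: nat
    proof (intro exI[of _ "Max (N ` {..k})"] allI impI)
      fix i assume i: "i \<ge> Max (N ` {..k})"
      have "(f i \<ominus>\<^bsub>S\<^esub> y) m = \<zero>" if "m \<notin> U" "size m < k" for m
      proof -
        have "N (Suc (size m)) \<le> i"
          using i that(2) by (intro order_trans[OF Max_ge i]) auto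
        from agree[OF this order_refl that(1)] that(1) have "f i m = y m"
          unfolding y_def by (simp only: if_False)
        then show ?thesis
          using f(1) y by (simp add: r_right_minus_eq)
      qed
      then have "h (f i \<ominus>\<^bsub>S\<^esub> y) \<in> h ` order_ideal k"
        using mem_iff[OF PS.minus_closed[OF f(1) y]] by blast
      then show "x i \<ominus>\<^bsub>R\<^esub> h y \<in> M [^]\<^bsub>ideals_set R\<^esub> k"
        by (simp only: pow[OF M] f(2) diff[OF f(1) y])
    qed
    moreover have "h y \<in> carrier R"
      using y by (rule hom_closed)
    ultimately show "\<exists>y\<in>carrier R. \<forall>k::nat. \<exists>N. \<forall>i\<ge>N. x i \<ominus>\<^bsub>R\<^esub> y \<in> M [^]\<^bsub>ideals_set R\<^esub> k"
      by blast
  qed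
qed

end

section \<open>Permutations of the variables\<close>

context power_series
begin

lemma surjective_hom_permute_variables:
  assumes \<sigma>: "bij \<sigma>" "\<sigma> ` V = V"
  shows "surjective_hom S S (\<lambda>f m. f (image_mset \<sigma> m))"
proof -
  let ?u = "\<lambda>(f :: 'i multiset \<Rightarrow> 'k) m. f (image_mset \<sigma> m)"
  have img: "set_mset (image_mset \<tau> m) \<subseteq> V \<longleftrightarrow> set_mset m \<subseteq> V"
    if "bij \<tau>" "\<tau> ` V = V" for \<tau> :: "'i \<Rightarrow> 'i" and m
  proof -
    have "\<tau> ` set_mset m \<subseteq> \<tau> ` V \<longleftrightarrow> set_mset m \<subseteq> V"
      using that(1) by (simp add: inj_image_subset_iff bij_is_inj)
    then show ?thesis
      by (simp add: that(2))
  qed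
  have closed: "(\<lambda>m. f (image_mset \<tau> m)) \<in> carrier S"
    if "bij \<tau>" "\<tau> ` V = V" "f \<in> carrier S" for \<tau> :: "'i \<Rightarrow> 'i" and f
    using that img[OF that(1,2)] unfolding series_carrier_iff by blast
  have sub: "{a. a \<subseteq># image_mset \<sigma> m} = image_mset \<sigma> ` {a. a \<subseteq># m}" for m
  proof (intro equalityI subsetI)
    fix a assume "a \<in> {a. a \<subseteq># image_mset \<sigma> m}"
    then obtain b where "image_mset \<sigma> m = a + b"
      by (auto simp: mset_subset_eq_exists_conv)
    then obtain a' b' where "m = a' + b'" "a = image_mset \<sigma> a'"
      using image_mset_eq_plusD by metis
    then show "a \<in> image_mset \<sigma> ` {a. a \<subseteq># m}"
      by auto
  qed (auto intro: image_mset_subseteq_mono)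
  have inj: "inj_on (image_mset \<sigma>) X" for X
    using \<sigma>(1) by (intro inj_on_inverseI[of _ "image_mset (inv_into UNIV \<sigma>)"])
      (simp add: image_mset.compositionality bij_is_inj)
  have ring_hom: "ring_hom_ring S S ?u"
  proof (rule ring_hom_ringI[OF PS.ring_axioms PS.ring_axioms])
    show "?u f \<in> carrier S" if "f \<in> carrier S" for f
      using closed[OF \<sigma> that] .
    show "?u (f \<otimes>\<^bsub>S\<^esub> g) = ?u f \<otimes>\<^bsub>S\<^esub> ?u g" if "f \<in> carrier S" "g \<in> carrier S" for f g
    proof
      fix m
      have "(f \<otimes>\<^bsub>S\<^esub> g) (image_mset \<sigma> m)
          = (\<Oplus>a\<in>{a. a \<subseteq># m}. f (image_mset \<sigma> a) \<otimes> g (image_mset \<sigma> m - image_mset \<sigma> a))"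
        unfolding coeff_mult sub using that by (intro finsum_reindex inj) auto
      also have "\<dots> = (\<Oplus>a\<in>{a. a \<subseteq># m}. f (image_mset \<sigma> a) \<otimes> g (image_mset \<sigma> (m - a)))"
        using that by (intro finsum_cong') (auto simp: image_mset_Diff)
      finally show "?u (f \<otimes>\<^bsub>S\<^esub> g) m = (?u f \<otimes>\<^bsub>S\<^esub> ?u g) m"
        by (simp add: coeff_mult)
    qed
    show "?u (f \<oplus>\<^bsub>S\<^esub> g) = ?u f \<oplus>\<^bsub>S\<^esub> ?u g" for f g
      by (auto simp: fun_eq_iff)
    show "?u \<one>\<^bsub>S\<^esub> = \<one>\<^bsub>S\<^esub>"
      by (auto simp: fun_eq_iff one_series coeff_monomial)
  qed
  have surj_u: "?u ` carrier S = carrier S"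
  proof (intro equalityI subsetI)
    fix f assume f: "f \<in> carrier S"
    have inv: "bij (inv_into UNIV \<sigma>)" "inv_into UNIV \<sigma> ` V = V"
      using bij_imp_bij_inv[OF \<sigma>(1)] image_inv_f_f[OF bij_is_inj[OF \<sigma>(1)], of V] \<sigma>(2) by simp_all
    have "f = ?u (\<lambda>m. f (image_mset (inv_into UNIV \<sigma>) m))"
      using \<sigma>(1) by (simp add: image_mset.compositionality bij_is_inj)
    then show "f \<in> ?u ` carrier S"
      using closed[OF inv f] by (rule image_eqI)
  qed (use closed[OF \<sigma>] in auto)
  show ?thesis
    using ring_hom_cringI[OF PS.is_cring PS.is_cring ring_hom_ring.homh[OF ring_hom]] surj_u
    by (simp only: surjective_hom_def surjective_hom_axioms_def simp_thms)
qed

end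

lemma ex_bij_exchanging_subsets:
  assumes "finite V" "A \<subseteq> V" "B \<subseteq> V" "card A = card B"
  shows "\<exists>\<sigma>. bij \<sigma> \<and> \<sigma> ` V = V \<and> \<sigma> ` A = B"
proof -
  have fin: "finite A" "finite B"
    using assms finite_subset by blast+
  obtain f where f: "bij_betw f A B"
    using finite_same_card_bij[OF fin assms(4)] by blast
  have "card (V - A) = card (V - B)"
    using assms fin by (simp add: card_Diff_subset)
  then obtain g where g: "bij_betw g (V - A) (V - B)"
    using finite_same_card_bij[of "V - A" "V - B"] assms(1) by blast
  define \<sigma> where "\<sigma> x = (if x \<in> A then f x else if x \<in> V then g x else x)" for x
  have A: "bij_betw \<sigma> A B"
    using f by (rule bij_betw_cong[THEN iffD1, rotated]) (simp add: \<sigma>_def)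
  have VA: "bij_betw \<sigma> (V - A) (V - B)"
    using g by (rule bij_betw_cong[THEN iffD1, rotated]) (simp add: \<sigma>_def)
  have nV: "bij_betw \<sigma> (- V) (- V)"
    using bij_betw_id by (rule bij_betw_cong[THEN iffD1, rotated]) (use assms(2) in \<open>auto simp: \<sigma>_def\<close>)
  have V: "bij_betw \<sigma> V V"
    using bij_betw_combine[OF A VA] assms by (simp add: Un_absorb1)
  have "bij \<sigma>"
    using bij_betw_combine[OF V nV] by simp
  with A V show ?thesis
    by (auto simp: bij_betw_def)
qed

section \<open>Quotients by intersections of variable ideals\<close>

text \<open>
  The sets \<open>\<phi> v\<close> of an admissible labeling, without the graph.
\<close>

locale variable_ideal_family = power_series_field K V
  for K :: "('k, 'b) ring_scheme" (structure) and V :: "'i set" +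
  fixes \<A> :: "'i set set" and s :: nat
  assumes nonempty: "\<A> \<noteq> {}"
    and subset_V: "A \<in> \<A> \<Longrightarrow> A \<subseteq> V"
    and card_eq: "A \<in> \<A> \<Longrightarrow> card A = s"
    and s_pos: "0 < s"
begin

text \<open>
  The monomials that lie in every \<open>variable_ideal A\<close>.
\<close>

definition transversal :: "'i multiset set"
  where "transversal = {m. \<forall>A\<in>\<A>. set_mset m \<inter> A \<noteq> {}}"

abbreviation I :: "('i multiset \<Rightarrow> 'k) set"
  where "I \<equiv> monomial_ideal transversal"

abbreviation R :: "('i multiset \<Rightarrow> 'k) set ring"
  where "R \<equiv> S Quot I"

abbreviation proj :: "('i multiset \<Rightarrow> 'k) \<Rightarrow> ('i multiset \<Rightarrow> 'k) set"
  where "proj \<equiv> (+>\<^bsub>S\<^esub>) I"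

definition component :: "'i set \<Rightarrow> ('i multiset \<Rightarrow> 'k) set set"
  where "component A = proj ` variable_ideal A"

lemma finite_member: "A \<in> \<A> \<Longrightarrow> finite A"
  using finite_subset[OF subset_V finite_V] .

lemma upward_closed_transversal: "upward_closed transversal"
proof (rule upward_closedI)
  fix m a assume "m \<in> transversal" "m \<subseteq># a"
  then show "a \<in> transversal"
    using set_mset_mono[of m a] unfolding transversal_def by blast
qed

sublocale proj: surjective_hom S R proj
  by (rule surjective_hom_quotient(1)[OF PS.is_cring ideal_monomial_ideal[OF upward_closed_transversal]])

lemma ker_proj: "a_kernel S R proj = I"
  by (rule surjective_hom_quotient(2)[OF PS.is_cring ideal_monomial_ideal[OF upward_closed_transversal]])

lemma I_eq_genideal:
  "I = Idl\<^bsub>S\<^esub> (monomial K ` {mset_set A | A. A \<subseteq> V \<and> mset_set A \<in> transversal})"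
proof (rule monomial_ideal_eq_genideal[OF upward_closed_transversal])
  have "{mset_set A | A. A \<subseteq> V \<and> mset_set A \<in> transversal} \<subseteq> mset_set ` Pow V"
    by auto
  then show "finite {mset_set A | A. A \<subseteq> V \<and> mset_set A \<in> transversal}"
    by (rule finite_subset) (simp add: finite_V)
  show "{mset_set A | A. A \<subseteq> V \<and> mset_set A \<in> transversal} \<subseteq> transversal \<inter> monomials"
    using finite_subset[OF _ finite_V] by auto
  fix m assume m: "m \<in> transversal \<inter> monomials"
  have "mset_set (set_mset m) \<subseteq># m"
    by (rule mset_set_set_mset_msubset)
  moreover have "mset_set (set_mset m) \<in> transversal"
    using m by (simp add: transversal_def)
  ultimately show "\<exists>b\<in>{mset_set A | A. A \<subseteq> V \<and> mset_set A \<in> transversal}. b \<subseteq># m"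
    using m by blast
qed

lemma I_le_variable_ideal: "A \<in> \<A> \<Longrightarrow> I \<subseteq> variable_ideal A"
  by (auto simp: monomial_ideal_def variable_ideal_iff transversal_def) blast

lemma variable_ideal_le_iff:
  assumes "A \<subseteq> V"
  shows "variable_ideal A \<subseteq> variable_ideal B \<longleftrightarrow> A \<subseteq> B"
proof
  show "A \<subseteq> B" if le: "variable_ideal A \<subseteq> variable_ideal B"
  proof
    fix i assume i: "i \<in> A"
    have "finite A"
      using finite_subset[OF assms finite_V] .
    then have "monomial K {#i#} \<in> variable_ideal B"
      using le i variable_ideal_subset_iff_variables[OF ideal_variable_ideal] assms by blast
    then have "\<forall>m. set_mset m \<inter> B = {} \<longrightarrow> monomial K {#i#} m = \<zero>"
      by (simp add: variable_ideal_iff)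
    from spec[OF this, of "{#i#}"] show "i \<in> B"
      by (auto simp: coeff_monomial)
  qed
qed (rule variable_ideal_mono)

text \<open>
  If \<open>Q\<close> misses a variable \<open>X\<^sub>i\<close> with \<open>i = c A\<close> for every \<open>A\<close>, the square-free product of these variables is a
  transversal monomial, and as \<open>Q\<close> is prime it cannot lie in \<open>Q\<close>.
\<close>

lemma prime_over_I:
  assumes Q: "primeideal Q S" and IQ: "I \<subseteq> Q"
  shows "\<exists>A\<in>\<A>. variable_ideal A \<subseteq> Q"
proof (rule ccontr)
  interpret Q: primeideal Q S by fact
  assume none: "\<not> (\<exists>A\<in>\<A>. variable_ideal A \<subseteq> Q)"
  have "\<forall>A\<in>\<A>. \<exists>i. i \<in> A \<and> monomial K {#i#} \<notin> Q"
  proof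
    fix A assume A: "A \<in> \<A>"
    then show "\<exists>i. i \<in> A \<and> monomial K {#i#} \<notin> Q"
      using none variable_ideal_subset_iff_variables[OF Q.is_ideal finite_member[OF A] subset_V[OF A]]
      by blast
  qed
  then obtain c where c: "\<And>A. A \<in> \<A> \<Longrightarrow> c A \<in> A" "\<And>A. A \<in> \<A> \<Longrightarrow> monomial K {#c A#} \<notin> Q"
    by metis
  have cV: "c ` \<A> \<subseteq> V"
    using c(1) subset_V by blast
  then have fin: "finite (c ` \<A>)"
    using finite_V finite_subset by blast
  have "mset_set (c ` \<A>) \<in> transversal"
    unfolding transversal_def using c(1) fin by auto
  then have "monomial K (mset_set (c ` \<A>)) \<in> Q"
    using IQ monomial_in_monomial_ideal[of "mset_set (c ` \<A>)" transversal] cV fin by auto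
  moreover have "monomial K (mset_set B) \<notin> Q" if "B \<subseteq> c ` \<A>" for B
    using finite_subset[OF that fin] that
  proof (induction B rule: finite_induct)
    case empty
    have "\<one>\<^bsub>S\<^esub> \<notin> Q"
      using Q.one_imp_carrier Q.I_notcarr by blast
    then show ?case
      by (simp add: one_series)
  next
    case (insert i B)
    then have i: "i \<in> V" "set_mset (mset_set B) \<subseteq> V" "monomial K {#i#} \<notin> Q"
      using cV c(2) by auto
    then have "monomial K (mset_set (insert i B)) = monomial K {#i#} \<otimes>\<^bsub>S\<^esub> monomial K (mset_set B)"
      using monomial_add[of "{#i#}" "mset_set B"] insert.hyps by simp
    moreover have "monomial K {#i#} \<otimes>\<^bsub>S\<^esub> monomial K (mset_set B) \<notin> Q"
      using Q.I_prime[of "monomial K {#i#}" "monomial K (mset_set B)"] insert i by auto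
    ultimately show ?case
      by simp
  qed
  ultimately show False
    by blast
qed

lemma minimal_primes_R: "minimal_primes R = component ` \<A>"
proof -
  have "minimal_primes R = (`) proj ` variable_ideal ` \<A>"
  proof (rule proj.minimal_primes_eq)
    show "primeideal p S \<and> proj.ker \<subseteq> p" if "p \<in> variable_ideal ` \<A>" for p
      unfolding ker_proj using that primeideal_variable_ideal I_le_variable_ideal by blast
    show "\<exists>p\<in>variable_ideal ` \<A>. p \<subseteq> q" if "primeideal q S" "proj.ker \<subseteq> q" for q
      using prime_over_I[OF that(1) that(2)[unfolded ker_proj]] by blast
    fix p q assume "p \<in> variable_ideal ` \<A>" "q \<in> variable_ideal ` \<A>" "p \<subseteq> q"
    then obtain A B where AB: "A \<in> \<A>" "B \<in> \<A>" "p = variable_ideal A" "q = variable_ideal B" "A \<subseteq> B"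
      using variable_ideal_le_iff subset_V by blast
    then have "A = B"
      using card_subset_eq[of B A] finite_member card_eq by simp
    with AB show "p = q" by simp
  qed
  then show ?thesis
    by (simp add: component_def image_image)
qed

lemma pull_component: "A \<in> \<A> \<Longrightarrow> proj.pull (component A) = variable_ideal A"
  unfolding component_def
  using I_le_variable_ideal by (intro proj.pull_image ideal_variable_ideal) (simp add: ker_proj)

lemma inj_on_component: "inj_on component \<A>"
proof (rule inj_onI)
  fix A B assume AB: "A \<in> \<A>" "B \<in> \<A>" "component A = component B"
  then have "variable_ideal A = variable_ideal B"
    using pull_component by metis
  then have "variable_ideal A \<subseteq> variable_ideal B" "variable_ideal B \<subseteq> variable_ideal A"
    by simp_all
  then show "A = B"
    using variable_ideal_le_iff[OF subset_V] AB(1,2) by blast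
qed

lemma complete_local_ring_R: "complete_local_ring R"
proof (rule complete_local_ring_monomial_quotient[OF proj.surjective_hom_axioms ker_proj])
  show "{#} \<notin> transversal"
    using nonempty by (auto simp: transversal_def)
qed

text \<open>
  The dimension of the quotient by \<open>J\<close>, expressed by prime ideals of \<open>S\<close>. This makes quotients of \<open>S\<close> and
  iterated quotients comparable.
\<close>

definition dim_over :: "('i multiset \<Rightarrow> 'k) set \<Rightarrow> enat"
  where "dim_over J = (SUP k\<in>{k. \<exists>Q. prime_chain S k Q \<and> J \<subseteq> Q 0}. enat k)"

text \<open>
  A permutation of the variables that carries those in \<open>B\<close> to those in \<open>A\<close>, followed by the projection modulo
  \<open>variable_ideal A\<close>, is a surjective homomorphism with kernel \<open>variable_ideal B\<close>. So both quotients have the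
  dimension of one and the same ring.
\<close>

lemma dim_over_variable_ideal_eq:
  assumes "A \<subseteq> V" "B \<subseteq> V" "card A = card B"
  shows "dim_over (variable_ideal A) = dim_over (variable_ideal B)"
proof -
  obtain \<sigma> where \<sigma>: "bij \<sigma>" "\<sigma> ` V = V" "\<sigma> ` A = B"
    using ex_bij_exchanging_subsets[OF finite_V assms] by blast
  define u where "u = (\<lambda>(f :: 'i multiset \<Rightarrow> 'k) m. f (image_mset \<sigma> m))"
  have u: "surjective_hom S S u"
    unfolding u_def by (rule surjective_hom_permute_variables[OF \<sigma>(1,2)])
  let ?q = "(+>\<^bsub>S\<^esub>) (variable_ideal A)"
  have q: "surjective_hom S (S Quot variable_ideal A) ?q"
    and ker_q: "a_kernel S (S Quot variable_ideal A) ?q = variable_ideal A"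
    using surjective_hom_quotient[OF PS.is_cring ideal_variable_ideal] by blast+
  have "a_kernel S (S Quot variable_ideal A) (?q \<circ> u) = {f \<in> carrier S. u f \<in> variable_ideal A}"
    using surjective_hom_comp(2)[OF u q] ker_q by simp
  also have "\<dots> = variable_ideal B"
  proof -
    have "u f \<in> variable_ideal A \<longleftrightarrow> f \<in> variable_ideal B" if f: "f \<in> carrier S" for f
    proof -
      interpret u: surjective_hom S S u by (rule u)
      have meets: "set_mset (image_mset \<sigma> m) \<inter> B = {} \<longleftrightarrow> set_mset m \<inter> A = {}" for m
      proof -
        have "\<sigma> ` set_mset m \<inter> \<sigma> ` A = \<sigma> ` (set_mset m \<inter> A)"
          by (rule image_Int[OF bij_is_inj[OF \<sigma>(1)], symmetric])
        then show ?thesis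
          by (simp add: \<sigma>(3))
      qed
      have onto: "\<exists>m'. m = image_mset \<sigma> m'" for m
        using \<sigma>(1) by (intro exI[of _ "image_mset (inv_into UNIV \<sigma>) m"])
          (simp add: image_mset.compositionality comp_def bij_is_surj surj_f_inv_f)
      have "(\<forall>m. set_mset m \<inter> A = {} \<longrightarrow> f (image_mset \<sigma> m) = \<zero>) \<longleftrightarrow>
          (\<forall>m. set_mset m \<inter> B = {} \<longrightarrow> f m = \<zero>)"
        using meets onto by metis
      then show ?thesis
        using f u.hom_closed[OF f] unfolding variable_ideal_iff u_def by simp
    qed
    moreover have "variable_ideal B \<subseteq> carrier S"
      by (auto simp: variable_ideal_iff)
    ultimately show ?thesis
      by blast
  qed
  finally have "krull_dim (S Quot variable_ideal A) = dim_over (variable_ideal B)"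
    using surjective_hom.krull_dim_eq[OF surjective_hom_comp(1)[OF u q]] by (simp add: dim_over_def)
  moreover have "krull_dim (S Quot variable_ideal A) = dim_over (variable_ideal A)"
    using surjective_hom.krull_dim_eq[OF q] ker_q by (simp add: dim_over_def)
  ultimately show ?thesis
    by simp
qed

lemma krull_dim_quotient_component:
  assumes A: "A \<in> \<A>"
  shows "krull_dim (R Quot component A) = dim_over (variable_ideal A)"
proof -
  let ?q = "(+>\<^bsub>R\<^esub>) (component A)"
  have id: "ideal (component A) R"
    unfolding component_def by (rule proj.ideal_image[OF ideal_variable_ideal])
  have q: "surjective_hom R (R Quot component A) ?q"
    and ker_q: "a_kernel R (R Quot component A) ?q = component A"
    using surjective_hom_quotient[OF proj.S.is_cring id] by blast+
  have "a_kernel S (R Quot component A) (?q \<circ> proj) = variable_ideal A"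
    using surjective_hom_comp(2)[OF proj.surjective_hom_axioms q] ker_q pull_component[OF A]
    by (simp add: proj.pull_def)
  then show ?thesis
    using surjective_hom.krull_dim_eq[OF surjective_hom_comp(1)[OF proj.surjective_hom_axioms q]]
    by (simp add: dim_over_def)
qed

text \<open>
  A chain of primes of \<open>R\<close> starts above one of the components, and all of these have equal dimension.
\<close>

lemma equidimensional_R: "equidimensional R"
proof -
  have "krull_dim R = dim_over (variable_ideal A)" if A: "A \<in> \<A>" for A
  proof (rule antisym)
    have dim_R: "krull_dim R = dim_over I"
      using proj.krull_dim_eq ker_proj by (simp add: dim_over_def)
    show "krull_dim R \<le> dim_over (variable_ideal A)"
      unfolding dim_R dim_over_def[of I]
    proof (rule SUP_least)
      fix k assume "k \<in> {k. \<exists>Q. prime_chain S k Q \<and> I \<subseteq> Q 0}"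
      then obtain Q where Q: "prime_chain S k Q" "I \<subseteq> Q 0"
        by blast
      then have "primeideal (Q 0) S"
        by (simp add: prime_chain_def)
      then obtain B where B: "B \<in> \<A>" "variable_ideal B \<subseteq> Q 0"
        using prime_over_I Q(2) by blast
      have "enat k \<le> dim_over (variable_ideal B)"
        unfolding dim_over_def using Q B by (intro SUP_upper) blast
      also have "\<dots> = dim_over (variable_ideal A)"
        using A B by (intro dim_over_variable_ideal_eq subset_V) (simp_all add: card_eq)
      finally show "enat k \<le> dim_over (variable_ideal A)" .
    qed
    show "dim_over (variable_ideal A) \<le> krull_dim R"
      unfolding dim_R dim_over_def using I_le_variable_ideal[OF A] by (intro SUP_subset_mono) auto
  qed
  then show ?thesis
    unfolding equidimensional_def minimal_primes_R using krull_dim_quotient_component by auto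
qed

text \<open>
  The height is the greatest length of a chain of primes over \<open>I\<close> that ends in \<open>variable_ideal (A \<union> B)\<close>.
  If \<open>A \<union> B\<close> has \<open>s + 1\<close> elements, any such chain starts above some \<open>variable_ideal D\<close> with
  \<open>A \<union> B = insert j D\<close>, and \<open>no_prime_between\<close> leaves room for one step only. If \<open>A \<union> B\<close> is larger, the chain
  through \<open>variable_ideal (insert i A)\<close> has two steps.
\<close>

lemma ideal_height_sum:
  assumes A: "A \<in> \<A>" and B: "B \<in> \<A>" and "A \<noteq> B"
  shows "ideal_height R (component A <+>\<^bsub>R\<^esub> component B) = 1 \<longleftrightarrow> card (A \<inter> B) = s - 1"
proof -
  let ?C = "A \<union> B"
  let ?N = "{k. \<exists>Q. prime_chain S k Q \<and> I \<subseteq> Q 0 \<and> Q k = variable_ideal ?C}"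
  have CV: "?C \<subseteq> V" and finC: "finite ?C"
    using A B subset_V finite_member by auto
  have IC: "I \<subseteq> variable_ideal ?C"
    using I_le_variable_ideal[OF A] variable_ideal_mono[of A ?C] by blast
  have carr: "variable_ideal D \<subseteq> carrier S" for D
    by (auto simp: variable_ideal_iff)
  have "component A <+>\<^bsub>R\<^esub> component B = proj ` variable_ideal ?C"
    unfolding component_def proj.image_set_add[OF carr carr, symmetric] set_add_variable_ideal ..
  then have height: "ideal_height R (component A <+>\<^bsub>R\<^esub> component B) = (SUP k\<in>?N. enat k)"
    using ideal_height_prime[OF proj.primeideal_image[OF primeideal_variable_ideal]]
      proj.prime_height_image[OF primeideal_variable_ideal] IC
    by (simp add: ker_proj)
  have not_le: "\<not> B \<subseteq> A"
    using card_subset_eq[of A B] finite_member[OF A] card_eq[OF A] card_eq[OF B] \<open>A \<noteq> B\<close> by auto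
  then obtain i where i: "i \<in> B" "i \<notin> A"
    by blast
  have iV: "i \<in> V"
    using i(1) B subset_V by blast
  have card_A: "card (insert i A) = s + 1"
    using i(2) finite_member[OF A] card_eq[OF A] by simp
  have cards: "card ?C + card (A \<inter> B) = s + s"
    using card_Un_Int[OF finite_member[OF A] finite_member[OF B]] card_eq A B by simp
  have card_ge: "card ?C \<ge> s + 1"
    using card_mono[OF finC, of "insert i A"] i(1) card_A by auto
  have strict: "variable_ideal A \<subset> variable_ideal ?C"
    using variable_ideal_strict_mono[of A ?C i] i iV by blast
  have one: "1 \<in> ?N"
    using strict I_le_variable_ideal[OF A] primeideal_variable_ideal
    by (intro CollectI exI[of _ "\<lambda>k. if k = 0 then variable_ideal A else variable_ideal ?C"])
      (auto simp: prime_chain_def)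
  have "(SUP k\<in>?N. enat k) = 1 \<longleftrightarrow> card ?C = s + 1"
  proof
    assume C: "card ?C = s + 1"
    have "k \<le> 1" if "k \<in> ?N" for k
    proof (rule ccontr)
      assume k: "\<not> k \<le> 1"
      from that obtain Q where Q: "prime_chain S k Q" "I \<subseteq> Q 0" "Q k = variable_ideal ?C"
        by blast
      have prime: "primeideal (Q i) S" if "i \<le> k" for i
        using Q(1) that by (simp add: prime_chain_def)
      have less: "Q i \<subset> Q (Suc i)" if "i < k" for i
        using Q(1) that by (simp add: prime_chain_def)
      have prime01: "primeideal (Q 0) S" "primeideal (Q 1) S"
        using k by (simp_all add: prime)
      have less01: "Q 0 \<subset> Q 1" and less12: "Q 1 \<subset> Q (Suc 1)"
        using less[of 0] less[of 1] k by simp_all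
      obtain D where D: "D \<in> \<A>" "variable_ideal D \<subseteq> Q 0"
        using prime_over_I[OF prime01(1) Q(2)] by blast
      have "Q 0 \<subseteq> variable_ideal ?C"
        using prime_chain_mono[OF Q(1), of 0 k] unfolding Q(3) by simp
      with D(2) have "variable_ideal D \<subseteq> variable_ideal ?C"
        by (rule order_trans)
      then have DC: "D \<subseteq> ?C"
        by (simp only: variable_ideal_le_iff[OF subset_V[OF D(1)]])
      have "card (?C - D) = 1"
        using C card_eq[OF D(1)] DC finite_member[OF D(1)] by (simp add: card_Diff_subset)
      then obtain j where j: "?C - D = {j}"
        by (auto simp: card_1_singleton_iff)
      then have Cj: "?C = insert j D"
        using DC by blast
      have "Q 1 \<subset> variable_ideal ?C"
        using less12 prime_chain_mono[OF Q(1), of "Suc 1" k] k unfolding Q(3) by simp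
      then have "Q 1 = variable_ideal D"
        using D less01 Cj CV by (intro no_prime_between[OF prime01(2), of D j]) auto
      with D(2) less01 show False
        by blast
    qed
    then have "(SUP k\<in>?N. enat k) \<le> 1"
      by (intro SUP_least) (simp add: one_enat_def)
    moreover have "1 \<le> (SUP k\<in>?N. enat k)"
      using SUP_upper[OF one, of enat] by (simp add: one_enat_def)
    ultimately show "(SUP k\<in>?N. enat k) = 1"
      by (rule antisym)
  next
    assume sup: "(SUP k\<in>?N. enat k) = 1"
    show "card ?C = s + 1"
    proof (rule ccontr)
      assume "card ?C \<noteq> s + 1"
      with card_A have "insert i A \<noteq> ?C"
        by auto
      then obtain j where j: "j \<in> ?C" "j \<notin> insert i A"
        using i(1) by blast
      have "variable_ideal A \<subset> variable_ideal (insert i A)"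
        using variable_ideal_strict_mono[of A "insert i A" i] i iV by blast
      moreover have "variable_ideal (insert i A) \<subset> variable_ideal ?C"
        using variable_ideal_strict_mono[of "insert i A" ?C j] i j CV by blast
      ultimately have "2 \<in> ?N"
        using I_le_variable_ideal[OF A] primeideal_variable_ideal
        by (intro CollectI exI[of _ "\<lambda>k. if k = 0 then variable_ideal A else
            if k = 1 then variable_ideal (insert i A) else variable_ideal ?C"])
          (auto simp: prime_chain_def)
      then have "enat 2 \<le> (SUP k\<in>?N. enat k)"
        by (rule SUP_upper)
      with sup show False
        by (simp add: one_enat_def)
    qed
  qed
  also have "\<dots> \<longleftrightarrow> card (A \<inter> B) = s - 1"
    using cards card_ge s_pos by auto
  finally show ?thesis
    unfolding height .
qed

end

section \<open>The graph of minimal primes\<close>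

lemma digraph_iso_with_projI:
  assumes bij: "bij_betw g (pverts H) (pverts G)"
    and H: "parcs H \<subseteq> pverts H \<times> pverts H" and G: "parcs G \<subseteq> pverts G \<times> pverts G"
    and arcs: "\<And>u v. u \<in> pverts H \<Longrightarrow> v \<in> pverts H \<Longrightarrow> (u, v) \<in> parcs H \<longleftrightarrow> (g u, g v) \<in> parcs G"
  shows "digraph_iso (with_proj H) (with_proj G)"
proof -
  let ?f = "\<lparr>iso_verts = g, iso_arcs = map_prod g g, iso_head = snd, iso_tail = fst\<rparr>"
  have inj: "inj_on g (pverts H)" and img: "g ` pverts H = pverts G"
    using bij by (auto simp: bij_betw_def)
  have "wf_digraph (with_proj H)"
    using H by unfold_locales auto
  moreover have "inj_on (map_prod g g) (parcs H)"
    using map_prod_inj_on[OF inj inj] H by (rule inj_on_subset)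
  ultimately have "pre_digraph.digraph_isomorphism (with_proj H) ?f"
    using inj by (auto simp: pre_digraph.digraph_isomorphism_def)
  moreover have "map_prod g g ` parcs H = parcs G"
  proof (intro equalityI subsetI)
    fix a assume "a \<in> map_prod g g ` parcs H"
    then obtain u v where uv: "(u, v) \<in> parcs H" "a = (g u, g v)"
      by auto
    with H arcs[of u v] show "a \<in> parcs G"
      by auto
  next
    fix a assume a: "a \<in> parcs G"
    with G img obtain u v where "u \<in> pverts H" "v \<in> pverts H" "a = (g u, g v)"
      by blast
    with a arcs[of u v] show "a \<in> map_prod g g ` parcs H"
      by force
  qed
  then have "with_proj G = app_iso ?f (with_proj H)"
    using img by (simp add: app_iso_def with_proj_def)
  ultimately show ?thesis
    unfolding digraph_iso_def by blast
qed

theorem theorem1p6: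
  fixes K :: "('k, 'b) ring_scheme"
    and G :: "'v pair_pre_digraph"
    and n s :: nat
    and \<phi> :: "'v \<Rightarrow> nat set"
  assumes "field K"
    and "pair_graph G"
    and "admissible_labeling G n s \<phi>"
  shows "\<exists>R. complete_local_ring R \<and> equidimensional R \<and>
    digraph_iso (with_proj (minimal_prime_graph R)) (with_proj G) \<and>
    (\<exists>S \<subseteq> squarefree_monomials K {1..n}.
      R = power_series_ring K {1..n} Quot (Idl\<^bsub>power_series_ring K {1..n}\<^esub> S))"
proof -
  interpret K: field K by fact
  interpret G: pair_graph G by fact
  from assms(3) have n: "n > 0" and s: "s > 0"
    and \<phi>: "\<And>v. v \<in> pverts G \<Longrightarrow> \<phi> v \<subseteq> {1..n} \<and> card (\<phi> v) = s"
    and inj: "inj_on \<phi> (pverts G)"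
    and cover: "(\<Union>v\<in>pverts G. \<phi> v) = {1..n}"
    and adj: "\<And>v w. v \<in> pverts G \<Longrightarrow> w \<in> pverts G \<Longrightarrow>
      (v, w) \<in> parcs G \<longleftrightarrow> card (\<phi> v \<inter> \<phi> w) = s - 1"
    unfolding admissible_labeling_def by blast+
  have "pverts G \<noteq> {}"
    using cover n by auto
  then interpret F: variable_ideal_family K "{1..n}" "\<phi> ` pverts G" s
    using \<phi> s by unfold_locales auto
  let ?vertex = "\<lambda>v. F.component (\<phi> v)"
  have "bij_betw ?vertex (pverts G) (minimal_primes F.R)"
    unfolding F.minimal_primes_R bij_betw_def
    using comp_inj_on[OF inj F.inj_on_component] by (auto simp: comp_def)
  then have bij: "bij_betw (the_inv_into (pverts G) ?vertex) (minimal_primes F.R) (pverts G)"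
    by (rule bij_betw_the_inv_into)
  have iso: "digraph_iso (with_proj (minimal_prime_graph F.R)) (with_proj G)"
  proof (rule digraph_iso_with_projI)
    show "bij_betw (the_inv_into (pverts G) ?vertex) (pverts (minimal_prime_graph F.R)) (pverts G)"
      using bij by (simp add: minimal_prime_graph_def)
    show "parcs (minimal_prime_graph F.R)
        \<subseteq> pverts (minimal_prime_graph F.R) \<times> pverts (minimal_prime_graph F.R)"
      by (auto simp: minimal_prime_graph_def)
    show "parcs G \<subseteq> pverts G \<times> pverts G"
      using G.in_arcs_imp_in_arcs_ends by (auto dest: G.wellformed)
    fix p q assume "p \<in> pverts (minimal_prime_graph F.R)" "q \<in> pverts (minimal_prime_graph F.R)"
    then have pq: "p \<in> minimal_primes F.R" "q \<in> minimal_primes F.R"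
      by (simp_all add: minimal_prime_graph_def)
    then obtain v w where vw: "v \<in> pverts G" "w \<in> pverts G" "p = ?vertex v" "q = ?vertex w"
      unfolding F.minimal_primes_R by blast
    have inj_v: "inj_on ?vertex (pverts G)"
      using comp_inj_on[OF inj F.inj_on_component] by (simp add: comp_def)
    have inv: "the_inv_into (pverts G) ?vertex p = v" "the_inv_into (pverts G) ?vertex q = w"
      using vw the_inv_into_f_f[OF inj_v] by simp_all
    have "(p, q) \<in> parcs (minimal_prime_graph F.R) \<longleftrightarrow>
        v \<noteq> w \<and> ideal_height F.R (p <+>\<^bsub>F.R\<^esub> q) = 1"
    proof -
      have "p = q \<longleftrightarrow> v = w"
        unfolding vw(3,4) by (rule inj_on_eq_iff[OF inj_v vw(1,2)])
      with pq show ?thesis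
        by (simp add: minimal_prime_graph_def)
    qed
    also have "\<dots> \<longleftrightarrow> card (\<phi> v \<inter> \<phi> w) = s - 1"
    proof (cases "v = w")
      case True
      with \<phi>[OF vw(1)] s show ?thesis
        by simp
    next
      case False
      then have "\<phi> v \<noteq> \<phi> w"
        using inj vw by (auto dest: inj_onD)
      with False vw F.ideal_height_sum[of "\<phi> v" "\<phi> w"] show ?thesis
        by simp
    qed
    finally show "(p, q) \<in> parcs (minimal_prime_graph F.R) \<longleftrightarrow>
        (the_inv_into (pverts G) ?vertex p, the_inv_into (pverts G) ?vertex q) \<in> parcs G"
      using adj[OF vw(1,2)] inv by simp
  qed
  let ?gens = "monomial K ` {mset_set A | A. A \<subseteq> {1..n} \<and> mset_set A \<in> F.transversal}"
  show ?thesis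
  proof (intro exI conjI)
    show "complete_local_ring F.R"
      by (rule F.complete_local_ring_R)
    show "equidimensional F.R"
      by (rule F.equidimensional_R)
    show "digraph_iso (with_proj (minimal_prime_graph F.R)) (with_proj G)"
      by (rule iso)
    show "?gens \<subseteq> squarefree_monomials K {1..n}"
      by (auto simp: squarefree_monomials_def intro: finite_subset)
    show "F.R = power_series_ring K {1..n} Quot (Idl\<^bsub>power_series_ring K {1..n}\<^esub> ?gens)"
      by (rule arg_cong[OF F.I_eq_genideal])
  qed
qed

end
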